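(* Let $K,\Omega,P_{\mathrm{leak}}\subset\mathbb{R}^m$ be measurable sets such that $\partial K$ has Lebesgue measure zero, $\Omega+P_{\mathrm{leak}}=\{\boldsymbol x+\boldsymbol y:\boldsymbol x\in\Omega,\boldsymbol y\in P_{\mathrm{leak}}\}\subset K$, and $\mathcal{D}(\mathbf 1_{\mathbb{R}^m\setminus P_{\mathrm{leak}}})\in L^\infty(\mathbb{R}^m)$. Then for all $h\in L^2(\Omega)$, $$\big\|\mathcal{D}(h)|_{\mathbb{R}^m\setminus K}\big\|\le\big\|\hat p^{\mathrm{leak}}\cdot\mathcal{F}(h)\big\|,\qquad \hat p^{\mathrm{leak}}(\boldsymbol\xi):=\big|\mathcal{D}(\mathbf 1_{\mathbb{R}^m\setminus P_{\mathrm{leak}}})(\boldsymbol\xi/\mathfrak f)\big|.$$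
   Context: Fourier transform $\mathcal{F}(f)(\boldsymbol\xi)=(2\pi)^{-m/2}\int e^{-\mathrm{i}\boldsymbol\xi\cdot\boldsymbol x}f(\boldsymbol x)\,\mathrm{d}\boldsymbol x$ (unitary on $L^2$, extended to tempered distributions). Fix $\mathfrak f>0$; the Fresnel propagator is $\mathcal{D}(h)=\mathcal{F}^{-1}(m_{\mathfrak f}\mathcal{F}(h))$ with $m_{\mathfrak f}(\boldsymbol\xi)=\exp(-\mathrm{i}|\boldsymbol\xi|^2/(2\mathfrak f))$, extended to tempered distributions by duality. $\mathbf 1_A$ is the indicator of $A$, $f|_A:=\mathbf 1_Af$, $L^2(\Omega)$ is the set of $h\in L^2(\mathbb{R}^m)$ with support in $\Omega$, $\|\cdot\|$ the $L^2(\mathbb{R}^m)$-norm. *)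

theory Defs
  imports "HOL-Analysis.Analysis"
begin

text \<open>Functions on R^m are modelled on an arbitrary euclidean space 'a, m = DIM('a).\<close>

fun iter_deriv :: "('a::euclidean_space \<Rightarrow> complex) \<Rightarrow> 'a list \<Rightarrow> 'a \<Rightarrow> complex" where
  "iter_deriv f [] = f"
| "iter_deriv f (v # vs) = (\<lambda>x. frechet_derivative (iter_deriv f vs) (at x) v)"

definition schwartz :: "('a::euclidean_space \<Rightarrow> complex) \<Rightarrow> bool" where
  "schwartz f \<longleftrightarrow>
     (\<forall>vs. set vs \<subseteq> Basis \<longrightarrow> (\<forall>x. iter_deriv f vs differentiable (at x))) \<and>
     (\<forall>vs. set vs \<subseteq> Basis \<longrightarrow> (\<forall>n::nat. \<exists>B. \<forall>x. (1 + norm x) ^ n * cmod (iter_deriv f vs x) \<le> B))"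

text \<open>Unitary Fourier transform (classical integral formula, used on Schwartz functions).\<close>
definition fourier :: "('a::euclidean_space \<Rightarrow> complex) \<Rightarrow> 'a \<Rightarrow> complex" where
  "fourier f \<xi> = complex_of_real ((2 * pi) powr (- real DIM('a) / 2)) *
     (LINT x|lebesgue. exp (- \<i> * complex_of_real (\<xi> \<bullet> x)) * f x)"

definition fourier_inv :: "('a::euclidean_space \<Rightarrow> complex) \<Rightarrow> 'a \<Rightarrow> complex" where
  "fourier_inv f x = complex_of_real ((2 * pi) powr (- real DIM('a) / 2)) *
     (LINT \<xi>|lebesgue. exp (\<i> * complex_of_real (\<xi> \<bullet> x)) * f \<xi>)"

definition fresnel_mult :: "real \<Rightarrow> 'a::euclidean_space \<Rightarrow> complex" where
  "fresnel_mult fr \<xi> = exp (- \<i> * complex_of_real ((norm \<xi>)\<^sup>2 / (2 * fr)))"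

definition fresnel :: "real \<Rightarrow> ('a::euclidean_space \<Rightarrow> complex) \<Rightarrow> 'a \<Rightarrow> complex" where
  "fresnel fr \<phi> = fourier_inv (\<lambda>\<xi>. fresnel_mult fr \<xi> * fourier \<phi> \<xi>)"

definition L2 :: "('a::euclidean_space \<Rightarrow> complex) \<Rightarrow> bool" where
  "L2 f \<longleftrightarrow> f \<in> borel_measurable lebesgue \<and> integrable lebesgue (\<lambda>x. (cmod (f x))\<^sup>2)"

definition L2_norm :: "('a::euclidean_space \<Rightarrow> complex) \<Rightarrow> real" where
  "L2_norm f = sqrt (LINT x|lebesgue. (cmod (f x))\<^sup>2)"

definition Linf :: "('a::euclidean_space \<Rightarrow> complex) \<Rightarrow> bool" where
  "Linf g \<longleftrightarrow> g \<in> borel_measurable lebesgue \<and> (\<exists>B. AE x in lebesgue. cmod (g x) \<le> B)"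

text \<open>Tempered-distribution identities (by duality with Schwartz test functions,
  bilinear pairing).  The Fresnel propagator is symmetric for this pairing,
  so D(T)(phi) = T(D(phi)); likewise F(T)(phi) = T(F(phi)).\<close>
definition is_fourier_of :: "('a::euclidean_space \<Rightarrow> complex) \<Rightarrow> ('a \<Rightarrow> complex) \<Rightarrow> bool" where
  "is_fourier_of T u \<longleftrightarrow> (\<forall>\<phi>. schwartz \<phi> \<longrightarrow>
      (LINT x|lebesgue. u x * \<phi> x) = (LINT x|lebesgue. T x * fourier \<phi> x))"

definition is_fresnel_of :: "real \<Rightarrow> ('a::euclidean_space \<Rightarrow> complex) \<Rightarrow> ('a \<Rightarrow> complex) \<Rightarrow> bool" where
  "is_fresnel_of fr T u \<longleftrightarrow> (\<forall>\<phi>. schwartz \<phi> \<longrightarrow>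
      (LINT x|lebesgue. u x * \<phi> x) = (LINT x|lebesgue. T x * fresnel fr \<phi> x))"

end

theory Submission
  imports Defs "HOL-Probability.Characteristic_Functions" "HOL-Complex_Analysis.Conformal_Mappings"
begin

text \<open>
  The propagator is convolution with the chirp \<open>k(x) = c exp(\<i> f |x|\<^sup>2 / 2)\<close>, so for \<open>x\<close> outside \<open>K\<close>
  and \<open>h\<close> supported in \<open>\<Omega>\<close> the kernel may be replaced by \<open>k\<close> cut off to the complement of \<open>P\<close>,
  because \<open>x - y\<close> avoids \<open>P\<close> for all \<open>y\<close> in \<open>\<Omega>\<close>. Up to a phase, the Fourier transform of the
  cut-off kernel is \<open>D(1\<^bsub>-P\<^esub>)(\<xi>/f)\<close>, and Plancherel gives the estimate.

  To make this rigorous without an \<open>L\<^sup>2\<close> theory of the Fourier transform, the distributional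
  identities are tested only with Gaussians. Testing \<open>v = F h\<close> with a translated Gaussian says that the
  Gaussian mollification of \<open>v\<close> is the classical transform of \<open>h exp(-\<delta>|x|\<^sup>2/2)\<close>. Testing
  \<open>w = D T\<close> with a Gaussian times \<open>exp(-\<i> f |\<eta>|\<^sup>2 / 2)\<close> says that the mollification of the dechirped and
  rescaled \<open>w\<close> is, up to a constant of known modulus, the classical transform of
  \<open>T exp(\<i> f |x|\<^sup>2 / 2) exp(-\<epsilon>|x|\<^sup>2/2)\<close>; this is used for both \<open>u = D h\<close> and \<open>g = D(1\<^bsub>-P\<^esub>)\<close>. All regularised
  functions are integrable, and only a one-sided Plancherel inequality, Jensen's inequality for the
  Gaussian and approximation of the identity in \<open>L\<^sup>1\<close> are needed to remove the regularisations.
\<close>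

section \<open>Fourier transforms of complex Gaussians\<close>

lemma integrable_gaussian_real:
  fixes a :: real assumes "a > 0"
  shows "integrable lborel (\<lambda>x::real. exp (- a * x\<^sup>2 / 2))"
proof -
  have "integrable lborel (\<lambda>x. normal_density 0 (1 / sqrt a) x)"
    using assms by (intro integrable_normal_density) auto
  then have "integrable lborel (\<lambda>x. normal_density 0 (1 / sqrt a) x * sqrt (2 * pi * (1 / sqrt a)\<^sup>2))"
    by simp
  moreover have "normal_density 0 (1 / sqrt a) x * sqrt (2 * pi * (1 / sqrt a)\<^sup>2) = exp (- a * x\<^sup>2 / 2)" for x
    using assms by (simp add: normal_density_def power_divide field_simps)
  ultimately show ?thesis by simp
qed

lemma integrable_complex_gaussian_real:
  fixes t :: real assumes "Re z > 0"
  shows "integrable lborel (\<lambda>x::real. exp (- z * of_real (x\<^sup>2) / 2) * cis (- (t * x)))"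
  by (rule Bochner_Integration.integrable_bound[OF integrable_gaussian_real[OF assms]])
    (auto simp: norm_mult cis_conv_exp)

lemma gaussian_ft_real_pos:
  fixes a t :: real assumes "a > 0"
  shows "(LINT x|lborel. exp (- of_real a * of_real (x\<^sup>2) / 2) * cis (- (t * x)))
       = csqrt (of_real (2 * pi) / of_real a) * exp (- of_real (t\<^sup>2) / (2 * of_real a))"
proof -
  define b where "b = 1 / sqrt a"
  have b: "b > 0" "a * b\<^sup>2 = 1" using assms by (auto simp: b_def power_divide)
  have *: "(LINT x|lborel. std_normal_density x *\<^sub>R cis (s * x)) = of_real (exp (- (s\<^sup>2) / 2))" for s
  proof -
    have "char std_normal_distribution s = (LINT x|lborel. std_normal_density x *\<^sub>R cis (s * x))"
      unfolding char_def cis_conv_exp by (subst integral_density) (simp_all add: normal_density_nonneg)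
    then show ?thesis by (simp add: char_std_normal_distribution)
  qed
  have "(LINT x|lborel. exp (- of_real a * of_real (x\<^sup>2) / 2) * cis (- (t * x)))
     = b *\<^sub>R (LINT x|lborel. exp (- of_real a * of_real ((0 + b * x)\<^sup>2) / 2) * cis (- (t * (0 + b * x))))"
    using b by (subst lborel_integral_real_affine[where c=b and t=0]) auto
  also have "(\<lambda>x. exp (- of_real a * of_real ((0 + b * x)\<^sup>2) / 2) * cis (- (t * (0 + b * x))))
      = (\<lambda>x. sqrt (2 * pi) *\<^sub>R (std_normal_density x *\<^sub>R cis ((- t * b) * x)))"
  proof
    fix x
    have "exp (- of_real a * of_real ((0 + b * x)\<^sup>2) / 2) = complex_of_real (exp (- (a * b\<^sup>2) * x\<^sup>2 / 2))"
      by (simp add: exp_of_real power_mult_distrib mult.assoc flip: of_real_mult of_real_power of_real_minus of_real_divide)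
         (simp flip: exp_of_real)
    then show "exp (- of_real a * of_real ((0 + b * x)\<^sup>2) / 2) * cis (- (t * (0 + b * x)))
      = sqrt (2 * pi) *\<^sub>R (std_normal_density x *\<^sub>R cis ((- t * b) * x))"
      unfolding b by (simp add: std_normal_density_def scaleR_conv_of_real mult_ac)
  qed
  also have "b *\<^sub>R (LINT x|lborel. sqrt (2 * pi) *\<^sub>R (std_normal_density x *\<^sub>R cis ((- t * b) * x)))
     = of_real (b * sqrt (2 * pi)) * of_real (exp (- ((- t * b)\<^sup>2) / 2))"
    unfolding integral_scaleR_right * by (simp add: scaleR_conv_of_real)
  also have "- ((- t * b)\<^sup>2) / 2 = - t\<^sup>2 / (2 * a)"
    using assms by (simp add: b_def power_divide power_mult_distrib)
  also have "b * sqrt (2 * pi) = sqrt (2 * pi / a)" by (simp add: b_def real_sqrt_divide)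
  also have "of_real (sqrt (2 * pi / a)) = csqrt (of_real (2 * pi / a))"
    using assms by (subst of_real_sqrt) auto
  finally show ?thesis by (simp flip: exp_of_real)
qed

lemma holomorphic_gaussian_ft_real:
  fixes t :: real
  shows "(\<lambda>z. LINT x|lborel. exp (- z * of_real (x\<^sup>2) / 2) * cis (- (t * x))) holomorphic_on {z. Re z > 0}"
proof (rule holomorphic_uniform_sequence[where
      f="\<lambda>n z. integral (cbox (- real n) (real n)) (\<lambda>x. exp (- z * of_real (x\<^sup>2) / 2) * cis (- (t * x)))"])
  let ?f = "\<lambda>z (x::real). exp (- z * of_real (x\<^sup>2) / 2) * cis (- (t * x))"
  show "open {z. Re z > 0}" by (rule open_halfspace_Re_gt)
  show "(\<lambda>z. integral (cbox (- real n) (real n)) (?f z)) holomorphic_on {z. Re z > 0}" for n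
  proof (rule leibniz_rule_holomorphic)
    show "((\<lambda>z. ?f z x) has_field_derivative (- of_real (x\<^sup>2) / 2) * ?f z x) (at z within {z. Re z > 0})" for z x
      by (auto intro!: derivative_eq_intros)
    show "?f z integrable_on cbox (- real n) (real n)" for z
      by (intro integrable_continuous continuous_intros) auto
    show "continuous_on ({z. Re z > 0} \<times> cbox (- real n) (real n)) (\<lambda>(z, x). (- of_real (x\<^sup>2) / 2) * ?f z x)"
      by (auto simp: case_prod_unfold intro!: continuous_intros)
    show "convex {z. Re z > 0}" by (rule convex_halfspace_Re_gt)
  qed
  fix w assume w: "w \<in> {z. Re z > 0}"
  define a where "a = Re w / 2"
  have a: "a > 0" using w by (simp add: a_def)
  have sub: "Re z \<ge> a" if "z \<in> cball w a" for z
  proof -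
    have "\<bar>Re (w - z)\<bar> \<le> cmod (w - z)" by (rule abs_Re_le_cmod)
    then show ?thesis using that by (auto simp: a_def dist_norm)
  qed
  let ?I = "\<lambda>n. cbox (- real n) (real n)"
  let ?E = "\<lambda>x::real. exp (- a * x\<^sup>2 / 2)"
  have intE: "integrable lborel ?E" by (rule integrable_gaussian_real[OF a])
  have tail: "(\<lambda>n. LINT x|lborel. indicator (- ?I n) x *\<^sub>R ?E x) \<longlonglongrightarrow> (LINT x|(lborel::real measure). (0::real))"
  proof (rule integral_dominated_convergence[where w="?E"])
    show "integrable lborel ?E" by (rule intE)
    show "AE x in lborel. (\<lambda>n. indicator (- ?I n) x *\<^sub>R ?E x) \<longlonglongrightarrow> 0"
    proof (rule AE_I2, rule tendsto_eventually)
      fix x :: real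
      obtain N where "real N \<ge> \<bar>x\<bar>" using real_arch_simple by blast
      then show "\<forall>\<^sub>F n in sequentially. indicator (- ?I n) x *\<^sub>R ?E x = 0"
        unfolding eventually_sequentially by (intro exI[of _ N]) (auto simp: indicator_def)
    qed
  qed (auto simp: indicator_def)
  have bd: "cmod (integral (?I n) (?f z) - (LINT x|lborel. ?f z x)) \<le> (LINT x|lborel. indicator (- ?I n) x *\<^sub>R ?E x)"
    if z: "z \<in> cball w a" for z n
  proof -
    have intf: "integrable lborel (?f z)"
      using sub[OF z] a by (intro integrable_complex_gaussian_real) auto
    have "set_integrable lborel (?I n) (?f z)"
      unfolding set_integrable_def by (intro integrable_mult_indicator intf) auto
    then have "integral (?I n) (?f z) = (LINT x|lborel. indicator (?I n) x *\<^sub>R ?f z x)"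
      by (subst set_borel_integral_eq_integral(2)[symmetric]) (auto simp: set_lebesgue_integral_def)
    then have "integral (?I n) (?f z) - (LINT x|lborel. ?f z x)
       = (LINT x|lborel. indicator (?I n) x *\<^sub>R ?f z x - ?f z x)"
      using Bochner_Integration.integral_diff[OF integrable_mult_indicator[OF _ intf] intf, of "?I n"] by simp
    also have "cmod \<dots> \<le> (LINT x|lborel. indicator (- ?I n) x *\<^sub>R ?E x)"
    proof (rule Bochner_Integration.integral_norm_bound_integral)
      show "integrable lborel (\<lambda>x. indicator (?I n) x *\<^sub>R ?f z x - ?f z x)"
        by (intro Bochner_Integration.integrable_diff integrable_mult_indicator intf) auto
      show "integrable lborel (\<lambda>x. indicator (- ?I n) x *\<^sub>R ?E x)"
        by (intro integrable_mult_indicator intE) auto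
      show "cmod (indicator (?I n) x *\<^sub>R ?f z x - ?f z x) \<le> indicator (- ?I n) x *\<^sub>R ?E x" for x
        using sub[OF z] by (auto simp: indicator_def norm_mult mult_right_mono)
    qed
    finally show ?thesis .
  qed
  have "uniform_limit (cball w a) (\<lambda>n z. integral (?I n) (?f z)) (\<lambda>z. LINT x|lborel. ?f z x) sequentially"
  proof (rule uniform_limitI)
    fix e :: real assume "e > 0"
    have "\<forall>\<^sub>F n in sequentially. (LINT x|lborel. indicator (- ?I n) x *\<^sub>R ?E x) < e"
      using order_tendstoD(2)[OF tail, of e] \<open>e > 0\<close> by simp
    then show "\<forall>\<^sub>F n in sequentially. \<forall>z\<in>cball w a. dist (integral (?I n) (?f z)) (LINT x|lborel. ?f z x) < e"
      unfolding dist_norm by eventually_elim (blast intro: le_less_trans[OF bd])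
  qed
  moreover have "cball w a \<subseteq> {z. Re z > 0}" using sub a by force
  ultimately show "\<exists>d>0. cball w d \<subseteq> {z. Re z > 0} \<and>
      uniform_limit (cball w d) (\<lambda>n z. integral (?I n) (?f z)) (\<lambda>z. LINT x|lborel. ?f z x) sequentially"
    using a by blast
qed

lemma Re_pos_imp_not_nonpos_Reals: "Re z > 0 \<Longrightarrow> z \<notin> \<real>\<^sub>\<le>\<^sub>0"
  by (auto simp: complex_nonpos_Reals_iff)

lemma Re_divide_of_real_pos: "Re z > 0 \<Longrightarrow> r > 0 \<Longrightarrow> Re (of_real r / z) > 0"
  by (simp add: Re_divide sum_power2_gt_zero_iff)

lemma gaussian_ft_real:
  fixes t :: real assumes "Re z > 0"
  shows "(LINT x|lborel. exp (- z * of_real (x\<^sup>2) / 2) * cis (- (t * x)))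
       = csqrt (of_real (2 * pi) / z) * exp (- of_real (t\<^sup>2) / (2 * z))" (is "?L z = ?R z")
proof -
  have "?L z - ?R z = 0"
  proof (rule analytic_continuation[where f="\<lambda>z. ?L z - ?R z" and S="{z. Re z > 0}" and U="of_real ` {0<..}" and \<xi>=1])
    have nr: "of_real (2 * pi) / z \<notin> \<real>\<^sub>\<le>\<^sub>0" if "Re z > 0" for z
      using that by (intro Re_pos_imp_not_nonpos_Reals Re_divide_of_real_pos) auto
    then show "(\<lambda>z. ?L z - ?R z) holomorphic_on {z. Re z > 0}"
      by (intro holomorphic_intros holomorphic_gaussian_ft_real) auto
    show "open {z. Re z > 0}" by (rule open_halfspace_Re_gt)
    show "connected {z. Re z > 0}" by (intro convex_connected convex_halfspace_Re_gt)
    show "complex_of_real ` {0<..} \<subseteq> {z. Re z > 0}" by auto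
    show "1 islimpt complex_of_real ` {0<..}"
      unfolding islimpt_approachable
    proof (intro allI impI)
      fix e :: real assume "e > 0"
      then show "\<exists>x'\<in>complex_of_real ` {0<..}. x' \<noteq> 1 \<and> dist x' 1 < e"
        by (intro bexI[of _ "of_real (1 + e/2)"] imageI) (auto simp: dist_norm)
    qed
    show "?L z - ?R z = 0" if "z \<in> complex_of_real ` {0<..}" for z
      using that gaussian_ft_real_pos by auto
  qed (use assms in auto)
  then show ?thesis by simp
qed

lemma integral_lborel_prod:
  fixes f :: "'a::euclidean_space \<Rightarrow> real \<Rightarrow> complex"
  assumes "\<And>b. b \<in> Basis \<Longrightarrow> integrable lborel (f b)"
  shows "integrable lborel (\<lambda>x. \<Prod>b\<in>Basis. f b (x \<bullet> b))"
    and "(LINT x|lborel. (\<Prod>b\<in>Basis. f b (x \<bullet> b))) = (\<Prod>b\<in>Basis. (LINT y|lborel. f b y))"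
proof -
  interpret product_sigma_finite "\<lambda>b::'a. lborel :: real measure" by standard
  have [measurable]: "b \<in> Basis \<Longrightarrow> f b \<in> borel_measurable borel" for b
    using assms by (auto dest: borel_measurable_integrable)
  have L: "(lborel :: 'a measure) = distr (\<Pi>\<^sub>M b\<in>Basis. lborel) borel (\<lambda>f. \<Sum>b\<in>Basis. f b *\<^sub>R b)"
    by (rule lborel_eq)
  have M: "(\<lambda>f. \<Sum>b\<in>Basis. f b *\<^sub>R b) \<in> (\<Pi>\<^sub>M b\<in>Basis. lborel) \<rightarrow>\<^sub>M (borel :: 'a measure)"
    by measurable
  have B: "(\<lambda>x. \<Prod>b\<in>Basis. f b (x \<bullet> b)) \<in> borel_measurable borel"
    by measurable
  have e: "(\<Prod>b\<in>Basis. f b ((\<Sum>b\<in>Basis. y b *\<^sub>R b) \<bullet> b)) = (\<Prod>b\<in>Basis. f b (y b))" for y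
    by (intro prod.cong refl) (simp add: inner_sum_left_Basis)
  show "integrable lborel (\<lambda>x. \<Prod>b\<in>Basis. f b (x \<bullet> b))"
    by (subst L, subst integrable_distr_eq[OF M B]) (unfold e, intro product_integrable_prod assms finite_Basis)
  show "(LINT x|lborel. (\<Prod>b\<in>Basis. f b (x \<bullet> b))) = (\<Prod>b\<in>Basis. (LINT y|lborel. f b y))"
    by (subst L, subst integral_distr[OF M B]) (unfold e, intro product_integral_prod assms finite_Basis)
qed

lemma norm_sq_eq_sum_Basis: "(norm (x::'a::euclidean_space))\<^sup>2 = (\<Sum>b\<in>Basis. (x \<bullet> b)\<^sup>2)"
  unfolding power2_norm_eq_inner by (subst euclidean_inner) (simp add: power2_eq_square)

lemma gaussian_ft:
  fixes \<xi> :: "'a::euclidean_space" assumes "Re z > 0"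
  shows "integrable lborel (\<lambda>x. exp (- z * of_real ((norm x)\<^sup>2) / 2) * cis (- (\<xi> \<bullet> x)))"
    and "(LINT x|lborel. exp (- z * of_real ((norm x)\<^sup>2) / 2) * cis (- (\<xi> \<bullet> x)))
       = csqrt (of_real (2 * pi) / z) ^ DIM('a) * exp (- of_real ((norm \<xi>)\<^sup>2) / (2 * z))"
proof -
  have e: "exp (- z * of_real ((norm x)\<^sup>2) / 2) * cis (- (\<xi> \<bullet> x))
     = (\<Prod>b\<in>Basis. exp (- z * of_real ((x \<bullet> b)\<^sup>2) / 2) * cis (- ((\<xi> \<bullet> b) * (x \<bullet> b))))" for x
    unfolding cis_conv_exp prod.distrib
    by (simp add: norm_sq_eq_sum_Basis euclidean_inner[of \<xi> x] sum_distrib_left sum_divide_distrib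
          flip: exp_sum sum_negf)
  note I = integrable_complex_gaussian_real[OF assms]
  show "integrable lborel (\<lambda>x. exp (- z * of_real ((norm x)\<^sup>2) / 2) * cis (- (\<xi> \<bullet> x)))"
    unfolding e by (rule integral_lborel_prod(1)[OF I])
  have "(LINT x|lborel. exp (- z * of_real ((norm x)\<^sup>2) / 2) * cis (- (\<xi> \<bullet> x)))
     = (\<Prod>b\<in>Basis. csqrt (of_real (2 * pi) / z) * exp (- of_real ((\<xi> \<bullet> b)\<^sup>2) / (2 * z)))"
    unfolding e by (subst integral_lborel_prod(2)[OF I]) (simp only: gaussian_ft_real[OF assms])
  also have "\<dots> = csqrt (of_real (2 * pi) / z) ^ DIM('a) * exp (- of_real ((norm \<xi>)\<^sup>2) / (2 * z))"
    by (simp add: prod.distrib norm_sq_eq_sum_Basis sum_divide_distrib flip: exp_sum sum_negf)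
  finally show "(LINT x|lborel. exp (- z * of_real ((norm x)\<^sup>2) / 2) * cis (- (\<xi> \<bullet> x))) = \<dots>" .
qed

section \<open>Chirped Gaussians are Schwartz functions\<close>

inductive cpoly :: "('a::euclidean_space \<Rightarrow> complex) \<Rightarrow> bool" where
  const: "cpoly (\<lambda>_. c)"
| inner: "cpoly (\<lambda>x. of_real (x \<bullet> b))"
| add: "cpoly p \<Longrightarrow> cpoly q \<Longrightarrow> cpoly (\<lambda>x. p x + q x)"
| mult: "cpoly p \<Longrightarrow> cpoly q \<Longrightarrow> cpoly (\<lambda>x. p x * q x)"

lemma cpoly_sum: "(\<And>i. i \<in> I \<Longrightarrow> cpoly (p i)) \<Longrightarrow> cpoly (\<lambda>x. \<Sum>i\<in>I. p i x)"
  by (induction I rule: infinite_finite_induct) (auto intro: cpoly.intros)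

lemma cpoly_norm_sq: "cpoly (\<lambda>x. of_real ((norm x)\<^sup>2))"
  unfolding norm_sq_eq_sum_Basis of_real_sum unfolding power2_eq_square of_real_mult
  by (intro cpoly_sum cpoly.intros)

lemma cpoly_has_derivative:
  assumes "cpoly p"
  shows "\<exists>p'. (\<forall>x. (p has_derivative (\<lambda>v. p' v x)) (at x)) \<and> (\<forall>v. cpoly (p' v))"
  using assms
proof induction
  case (const c)
  show ?case by (intro exI[of _ "\<lambda>_ _. 0"]) (auto intro: cpoly.intros)
next
  case (inner b)
  show ?case
    by (intro exI[of _ "\<lambda>v _. of_real (v \<bullet> b)"]) (auto intro!: cpoly.intros derivative_eq_intros)
next
  case (add p q)
  then obtain p' q' where "\<forall>x. (p has_derivative (\<lambda>v. p' v x)) (at x)" "\<forall>v. cpoly (p' v)"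
    "\<forall>x. (q has_derivative (\<lambda>v. q' v x)) (at x)" "\<forall>v. cpoly (q' v)" by blast
  then show ?case
    by (intro exI[of _ "\<lambda>v x. p' v x + q' v x"]) (auto intro!: cpoly.intros has_derivative_add)
next
  case (mult p q)
  then obtain p' q' where "\<forall>x. (p has_derivative (\<lambda>v. p' v x)) (at x)" "\<forall>v. cpoly (p' v)"
    "\<forall>x. (q has_derivative (\<lambda>v. q' v x)) (at x)" "\<forall>v. cpoly (q' v)" by blast
  with mult.hyps show ?case
    by (intro exI[of _ "\<lambda>v x. p x * q' v x + p' v x * q x"])
       (auto intro!: cpoly.intros has_derivative_mult)
qed

lemma cpoly_growth:
  assumes "cpoly p"
  shows "\<exists>B n. B \<ge> 0 \<and> (\<forall>x. cmod (p x) \<le> B * (1 + norm x) ^ n)"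
  using assms
proof induction
  case (const c)
  show ?case by (intro exI[of _ "cmod c"] exI[of _ 0]) auto
next
  case (inner b)
  have "\<bar>x \<bullet> b\<bar> \<le> norm b * (1 + norm x) ^ 1" for x
    using Cauchy_Schwarz_ineq2[of x b] by (simp add: algebra_simps) (smt (verit) norm_ge_zero)
  then show ?case by (intro exI[of _ "norm b"] exI[of _ 1]) auto
next
  case (add p q)
  then obtain B m C n where B: "B \<ge> 0" "\<And>x. cmod (p x) \<le> B * (1 + norm x) ^ m"
    and C: "C \<ge> 0" "\<And>x. cmod (q x) \<le> C * (1 + norm x) ^ n" by metis
  have "cmod (p x + q x) \<le> (B + C) * (1 + norm x) ^ (m + n)" for x
  proof -
    have "B * (1 + norm x) ^ m \<le> B * (1 + norm x) ^ (m + n)"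
      "C * (1 + norm x) ^ n \<le> C * (1 + norm x) ^ (m + n)"
      using B C by (intro mult_left_mono power_increasing; simp)+
    then show ?thesis using B(2)[of x] C(2)[of x] norm_triangle_ineq[of "p x" "q x"]
      by (simp add: distrib_right)
  qed
  with B(1) C(1) show ?case by (intro exI[of _ "B + C"] exI[of _ "m + n"]) auto
next
  case (mult p q)
  then obtain B m C n where B: "B \<ge> 0" "\<And>x. cmod (p x) \<le> B * (1 + norm x) ^ m"
    and C: "C \<ge> 0" "\<And>x. cmod (q x) \<le> C * (1 + norm x) ^ n" by metis
  have "cmod (p x * q x) \<le> (B * C) * (1 + norm x) ^ (m + n)" for x
  proof -
    have "cmod (p x) * cmod (q x) \<le> (B * (1 + norm x) ^ m) * (C * (1 + norm x) ^ n)"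
      using B C by (intro mult_mono) auto
    then show ?thesis by (simp add: norm_mult power_add mult_ac)
  qed
  with B(1) C(1) show ?case by (intro exI[of _ "B * C"] exI[of _ "m + n"]) auto
qed

lemma power_times_gaussian_bounded:
  fixes \<alpha> \<beta> c :: real
  assumes "\<alpha> > 0"
  shows "\<exists>B. \<forall>t\<ge>0. (1 + t) ^ n * exp (c + \<beta> * t - \<alpha> * t\<^sup>2) \<le> B"
proof (intro exI allI impI)
  fix t :: real assume t: "t \<ge> 0"
  have 1: "(1 + t) ^ n \<le> fact n * exp (1 + t)"
  proof -
    have "(1 + t) ^ n / fact n \<le> exp (1 + t)"
    proof -
      have "(\<lambda>k. (1 + t) ^ k /\<^sub>R fact k) sums exp (1 + t)" by (rule exp_converges)
      then have "sum (\<lambda>k. (1 + t) ^ k /\<^sub>R fact k) {n} \<le> exp (1 + t)"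
        using t sum_le_suminf[of "\<lambda>k. (1 + t) ^ k /\<^sub>R fact k" "{n}"] by (simp add: sums_iff)
      then show ?thesis by (simp add: divide_inverse mult.commute)
    qed
    then show ?thesis by (simp add: field_simps)
  qed
  have "0 \<le> (\<alpha> * t - (1 + \<beta>) / 2)\<^sup>2 / \<alpha>" using assms by simp
  also have "\<dots> = \<alpha> * t\<^sup>2 - (1 + \<beta>) * t + (1 + \<beta>)\<^sup>2 / (4 * \<alpha>)"
    using assms by (simp add: power2_eq_square field_simps)
  finally have 2: "1 + t + (c + \<beta> * t - \<alpha> * t\<^sup>2) \<le> 1 + c + (1 + \<beta>)\<^sup>2 / (4 * \<alpha>)"
    by (simp add: algebra_simps)
  have "(1 + t) ^ n * exp (c + \<beta> * t - \<alpha> * t\<^sup>2) \<le> fact n * exp (1 + t) * exp (c + \<beta> * t - \<alpha> * t\<^sup>2)"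
    using 1 by (intro mult_right_mono) auto
  also have "\<dots> = fact n * exp (1 + t + (c + \<beta> * t - \<alpha> * t\<^sup>2))" by (simp add: exp_add)
  also have "\<dots> \<le> fact n * exp (1 + c + (1 + \<beta>)\<^sup>2 / (4 * \<alpha>))"
    using 2 by (intro mult_left_mono) auto
  finally show "(1 + t) ^ n * exp (c + \<beta> * t - \<alpha> * t\<^sup>2) \<le> fact n * exp (1 + c + (1 + \<beta>)\<^sup>2 / (4 * \<alpha>))" .
qed

lemma schwartz_exp_cpoly:
  fixes Q :: "'a::euclidean_space \<Rightarrow> complex"
  assumes Q: "cpoly Q" and "\<alpha> > 0"
    and bound: "\<And>x. Re (Q x) \<le> c + \<beta> * norm x - \<alpha> * (norm x)\<^sup>2"
  shows "schwartz (\<lambda>x. exp (Q x))"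
proof -
  obtain Q' where Q': "\<And>x. (Q has_derivative (\<lambda>v. Q' v x)) (at x)" "\<And>v. cpoly (Q' v)"
    using cpoly_has_derivative[OF Q] by blast
  have deriv: "\<exists>p'. (\<forall>x. ((\<lambda>x. p x * exp (Q x)) has_derivative (\<lambda>v. p' v x * exp (Q x))) (at x)) \<and> (\<forall>v. cpoly (p' v))"
    if p: "cpoly p" for p
  proof -
    obtain p' where p': "\<And>x. (p has_derivative (\<lambda>v. p' v x)) (at x)" "\<And>v. cpoly (p' v)"
      using cpoly_has_derivative[OF p] by blast
    have "((\<lambda>x. p x * exp (Q x)) has_derivative (\<lambda>v. (p x * Q' v x + p' v x) * exp (Q x))) (at x)" for x
      by (rule has_derivative_eq_rhs, rule has_derivative_mult[OF p'(1)],
          rule has_derivative_compose[OF Q'(1) DERIV_exp[THEN has_field_derivative_imp_has_derivative]])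
         (simp add: algebra_simps)
    moreover have "cpoly (\<lambda>x. p x * Q' v x + p' v x)" for v
      by (intro cpoly.intros p p' Q')
    ultimately show ?thesis by (intro exI[of _ "\<lambda>v x. p x * Q' v x + p' v x"]) blast
  qed
  have iter: "\<exists>p. cpoly p \<and> iter_deriv (\<lambda>x. exp (Q x)) vs = (\<lambda>x. p x * exp (Q x))" for vs
  proof (induction vs)
    case Nil
    show ?case by (intro exI[of _ "\<lambda>_. 1"]) (auto intro: cpoly.intros)
  next
    case (Cons v vs)
    then obtain p where p: "cpoly p" "iter_deriv (\<lambda>x. exp (Q x)) vs = (\<lambda>x. p x * exp (Q x))" by blast
    obtain p' where p': "\<And>x. ((\<lambda>x. p x * exp (Q x)) has_derivative (\<lambda>v. p' v x * exp (Q x))) (at x)"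
      "\<And>v. cpoly (p' v)" using deriv[OF p(1)] by blast
    have "iter_deriv (\<lambda>x. exp (Q x)) (v # vs) = (\<lambda>x. p' v x * exp (Q x))"
      by (simp add: p(2) frechet_derivative_at[OF p'(1), symmetric])
    with p'(2) show ?case by blast
  qed
  show ?thesis
    unfolding schwartz_def
  proof (intro conjI allI impI)
    fix vs :: "'a list" and x :: 'a and n :: nat
    obtain p where p: "cpoly p" "iter_deriv (\<lambda>x. exp (Q x)) vs = (\<lambda>x. p x * exp (Q x))"
      using iter by blast
    show "iter_deriv (\<lambda>x. exp (Q x)) vs differentiable (at x)"
      using deriv[OF p(1)] unfolding p(2) differentiable_def by blast
    obtain B m where B: "B \<ge> 0" "\<And>x. cmod (p x) \<le> B * (1 + norm x) ^ m"
      using cpoly_growth[OF p(1)] by blast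
    obtain D where D: "\<And>t. t \<ge> 0 \<Longrightarrow> (1 + t) ^ (n + m) * exp (c + \<beta> * t - \<alpha> * t\<^sup>2) \<le> D"
      using power_times_gaussian_bounded[OF \<open>\<alpha> > 0\<close>] by meson
    show "\<exists>B. \<forall>x. (1 + norm x) ^ n * cmod (iter_deriv (\<lambda>x. exp (Q x)) vs x) \<le> B"
    proof (intro exI allI)
      fix x
      have "(1 + norm x) ^ n * cmod (iter_deriv (\<lambda>x. exp (Q x)) vs x)
         = (1 + norm x) ^ n * (cmod (p x) * exp (Re (Q x)))"
        by (simp add: p(2) norm_mult)
      also have "\<dots> \<le> (1 + norm x) ^ n * ((B * (1 + norm x) ^ m) * exp (c + \<beta> * norm x - \<alpha> * (norm x)\<^sup>2))"
        using B bound[of x] by (intro mult_left_mono mult_mono) auto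
      also have "\<dots> = B * ((1 + norm x) ^ (n + m) * exp (c + \<beta> * norm x - \<alpha> * (norm x)\<^sup>2))"
        by (simp add: power_add)
      also have "\<dots> \<le> B * D" using B D by (intro mult_left_mono) auto
      finally show "(1 + norm x) ^ n * cmod (iter_deriv (\<lambda>x. exp (Q x)) vs x) \<le> B * D" .
    qed
  qed
qed

lemma schwartz_chirped_gaussian:
  fixes a :: "'a::euclidean_space"
  assumes "e > 0" "s \<noteq> 0"
  shows "schwartz (\<lambda>x. of_real (c * exp (- (norm (s *\<^sub>R x - a))\<^sup>2 / (2 * e))) * cis (r * (norm x)\<^sup>2))"
proof (cases "c = 0")
  case True
  have "iter_deriv (\<lambda>x. 0) vs = (\<lambda>x. 0)" for vs :: "'a list"
    by (induction vs) auto
  with True show ?thesis by (auto simp: schwartz_def)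
next
  case False
  have nz: "complex_of_real c \<noteq> 0" using False by simp
  let ?Q = "\<lambda>x. Ln (of_real c) + (of_real (- s\<^sup>2 / (2 * e)) + \<i> * of_real r) * of_real ((norm x)\<^sup>2)
     + of_real (s / e) * of_real (x \<bullet> a) + of_real (- (norm a)\<^sup>2 / (2 * e))"
  have "of_real (c * exp (- (norm (s *\<^sub>R x - a))\<^sup>2 / (2 * e))) * cis (r * (norm x)\<^sup>2) = exp (?Q x)" for x
  proof -
    have "(norm (s *\<^sub>R x - a))\<^sup>2 = s\<^sup>2 * (norm x)\<^sup>2 - 2 * s * (x \<bullet> a) + (norm a)\<^sup>2"
      by (simp only: power2_norm_eq_inner)
         (simp add: inner_diff_left inner_diff_right inner_commute power2_eq_square algebra_simps)
    then have *: "- (norm (s *\<^sub>R x - a))\<^sup>2 / (2 * e) = - s\<^sup>2 / (2 * e) * (norm x)\<^sup>2 + s / e * (x \<bullet> a) + - (norm a)\<^sup>2 / (2 * e)"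
      unfolding \<open>(norm (s *\<^sub>R x - a))\<^sup>2 = _\<close> using assms by (simp add: field_simps)
    have "exp (?Q x) = exp (Ln (of_real c)) * exp (of_real (- s\<^sup>2 / (2 * e) * (norm x)\<^sup>2 + s / e * (x \<bullet> a) + - (norm a)\<^sup>2 / (2 * e))) * exp (\<i> * of_real (r * (norm x)\<^sup>2))"
      unfolding exp_add[symmetric] by (rule arg_cong[where f=exp]) (simp add: algebra_simps)
    also have "\<dots> = of_real (c * exp (- (norm (s *\<^sub>R x - a))\<^sup>2 / (2 * e))) * cis (r * (norm x)\<^sup>2)"
      unfolding * using nz by (simp add: cis_conv_exp flip: exp_of_real)
    finally show ?thesis by simp
  qed
  moreover have "schwartz (\<lambda>x. exp (?Q x))"
  proof (rule schwartz_exp_cpoly)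
    show "cpoly ?Q"
      by (rule cpoly.add[OF cpoly.add[OF cpoly.add[OF cpoly.const cpoly.mult[OF cpoly.const cpoly_norm_sq]]
            cpoly.mult[OF cpoly.const cpoly.inner]] cpoly.const])
    show "s\<^sup>2 / (2 * e) > 0" using assms by simp
    fix x :: 'a
    have "s / e * (x \<bullet> a) \<le> \<bar>s / e\<bar> * \<bar>x \<bullet> a\<bar>" by (metis abs_ge_self abs_mult)
    also have "\<dots> \<le> \<bar>s / e\<bar> * (norm x * norm a)"
      by (intro mult_left_mono Cauchy_Schwarz_ineq2) auto
    finally show "Re (?Q x) \<le> (Re (Ln (of_real c)) - (norm a)\<^sup>2 / (2 * e)) + (\<bar>s / e\<bar> * norm a) * norm x - s\<^sup>2 / (2 * e) * (norm x)\<^sup>2"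
      by (simp add: mult_ac)
  qed
  ultimately show ?thesis by presburger
qed

section \<open>Gaussian mollification\<close>

lemma integral_lborel_affine:
  fixes f :: "'a::euclidean_space \<Rightarrow> 'b::{banach,second_countable_topology}" and c :: real
  assumes [measurable]: "f \<in> borel_measurable borel" and c: "c \<noteq> 0"
  shows "(LINT x|lborel. f x) = \<bar>c\<bar> ^ DIM('a) *\<^sub>R (LINT x|lborel. f (t + c *\<^sub>R x))"
    and "integrable lborel (\<lambda>x. f (t + c *\<^sub>R x)) \<longleftrightarrow> integrable lborel f"
proof -
  show "(LINT x|lborel. f x) = \<bar>c\<bar> ^ DIM('a) *\<^sub>R (LINT x|lborel. f (t + c *\<^sub>R x))"
    by (subst lborel_affine[OF c, of t]) (simp add: integral_density integral_distr)
  have "integrable lborel f \<longleftrightarrow> integrable lborel (\<lambda>x. \<bar>c\<bar> ^ DIM('a) *\<^sub>R f (t + c *\<^sub>R x))"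
    by (subst lborel_affine[OF c, of t]) (simp add: integrable_density integrable_distr_eq)
  moreover have "integrable lborel (\<lambda>x. f (t + c *\<^sub>R x))"
    if "integrable lborel (\<lambda>x. \<bar>c\<bar> ^ DIM('a) *\<^sub>R f (t + c *\<^sub>R x))"
    using integrable_scaleR_right[of "inverse (\<bar>c\<bar> ^ DIM('a))", OF that] c by simp
  ultimately show "integrable lborel (\<lambda>x. f (t + c *\<^sub>R x)) \<longleftrightarrow> integrable lborel f"
    by auto
qed

lemma integral_lborel_shift:
  fixes f :: "'a::euclidean_space \<Rightarrow> 'b::{banach,second_countable_topology}"
  assumes "integrable lborel f"
  shows "integrable lborel (\<lambda>x. f (x + t))" "(LINT x|lborel. f (x + t)) = (LINT x|lborel. f x)"
    "integrable lborel (\<lambda>x. f (x - t))" "(LINT x|lborel. f (x - t)) = (LINT x|lborel. f x)"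
    "integrable lborel (\<lambda>x. f (t - x))" "(LINT x|lborel. f (t - x)) = (LINT x|lborel. f x)"
proof -
  have f: "f \<in> borel_measurable borel" using assms by auto
  show "integrable lborel (\<lambda>x. f (x + t))" "(LINT x|lborel. f (x + t)) = (LINT x|lborel. f x)"
    using integral_lborel_affine[OF f, of 1 t] assms by (simp_all add: add.commute)
  show "integrable lborel (\<lambda>x. f (x - t))" "(LINT x|lborel. f (x - t)) = (LINT x|lborel. f x)"
    using integral_lborel_affine[OF f, of 1 "- t"] assms by simp_all
  show "integrable lborel (\<lambda>x. f (t - x))" "(LINT x|lborel. f (t - x)) = (LINT x|lborel. f x)"
    using integral_lborel_affine[OF f, of "-1" t] assms by simp_all
qed

lemma translation_tendsto_L1:
  fixes f :: "'a::euclidean_space \<Rightarrow> 'b::{banach,second_countable_topology}"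
  assumes "integrable lborel f" and t: "t \<longlonglongrightarrow> 0"
  shows "(\<lambda>n. LINT x|lborel. norm (f (x + t n) - f x)) \<longlonglongrightarrow> 0"
  using assms(1)
proof (induction rule: integrable_induct)
  case (base A c)
  then have A[measurable]: "A \<in> sets borel" and Afin: "emeasure lborel A < \<infinity>" by auto
  let ?A = "\<lambda>x. indicator A x :: real"
  have iA: "integrable lborel ?A" using A Afin by simp
  have "(\<lambda>n. LINT x|lborel. \<bar>?A (x + t n) - ?A x\<bar>) \<longlonglongrightarrow> 0"
  proof (rule tendstoI)
    fix e :: real assume "e > 0"
    then have "e / 4 > 0" by simp
    from outer_regular_lborel[OF A this] obtain U where U: "open U" "A \<subseteq> U" "emeasure lborel (U - A) < e / 4"
      by blast
    \<comment> \<open>Points of \<open>A\<close> stay in the open set \<open>U\<close> under small shifts, so shifting loses at most the measure of \<open>U - A\<close>.\<close>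
    let ?U = "\<lambda>x. indicator U x :: real" and ?D = "\<lambda>x. indicator (U - A) x :: real"
    have [measurable]: "U \<in> sets borel" using U by simp
    have iD: "integrable lborel ?D" using order.strict_trans[OF U(3) ennreal_less_top] by (intro integrable_real_indicator) auto
    have mD: "(LINT x|lborel. ?D x) < e / 4"
    proof -
      have "emeasure lborel (U - A) = ennreal (measure lborel (U - A))"
        using U(3) by (intro emeasure_eq_ennreal_measure) (auto simp: top_unique)
      then show ?thesis using U(3) \<open>e > 0\<close> by (simp add: ennreal_less_iff)
    qed
    have lim: "(\<lambda>n. LINT x|lborel. ?A x * (1 - ?U (x + t n))) \<longlonglongrightarrow> (LINT x|(lborel::'a measure). (0::real))"
    proof (rule integral_dominated_convergence[where w="?A"])
      show "integrable lborel ?A" by (rule iA)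
      show "AE x in lborel. (\<lambda>n. ?A x * (1 - ?U (x + t n))) \<longlonglongrightarrow> 0"
      proof (rule AE_I2)
        fix x
        show "(\<lambda>n. ?A x * (1 - ?U (x + t n))) \<longlonglongrightarrow> 0"
        proof (cases "x \<in> A")
          case True
          have "(\<lambda>n. x + t n) \<longlonglongrightarrow> x + 0" by (intro tendsto_intros t)
          then have "\<forall>\<^sub>F n in sequentially. x + t n \<in> U"
            using U True by (auto dest!: topological_tendstoD[where S=U])
          then show ?thesis by (intro tendsto_eventually) (auto simp: indicator_def elim!: eventually_mono)
        qed simp
      qed
    qed (auto simp: indicator_def)
    have bd: "(LINT x|lborel. \<bar>?A (x + t n) - ?A x\<bar>)
       \<le> 2 * (LINT x|lborel. ?A x * (1 - ?U (x + t n))) + 2 * (LINT x|lborel. ?D x)" for n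
    proof -
      have i1: "integrable lborel (\<lambda>x. ?A x * (1 - ?U (x + t n)))"
        by (rule Bochner_Integration.integrable_bound[OF iA]) (auto simp: indicator_def)
      note i2 = integral_lborel_shift[OF iA, of "t n"] and i3 = integral_lborel_shift[OF iD, of "t n"]
      have "(LINT x|lborel. \<bar>?A (x + t n) - ?A x\<bar>)
        \<le> (LINT x|lborel. ?A (x + t n) - ?A x + 2 * (?A x * (1 - ?U (x + t n))) + 2 * ?D (x + t n))"
        using i1 i2 i3 iA iD U(2) by (intro integral_mono) (auto simp: indicator_def)
      also have "\<dots> = 2 * (LINT x|lborel. ?A x * (1 - ?U (x + t n))) + 2 * (LINT x|lborel. ?D x)"
        using i1 i2 i3 iA iD by simp
      finally show ?thesis .
    qed
    have "\<forall>\<^sub>F n in sequentially. (LINT x|lborel. ?A x * (1 - ?U (x + t n))) < e / 4"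
      using order_tendstoD(2)[OF lim, of "e/4"] \<open>e > 0\<close> by simp
    then show "\<forall>\<^sub>F n in sequentially. dist (LINT x|lborel. \<bar>?A (x + t n) - ?A x\<bar>) 0 < e"
    proof eventually_elim
      case (elim n)
      have "(LINT x|lborel. \<bar>?A (x + t n) - ?A x\<bar>) \<ge> 0" by simp
      with elim bd[of n] mD show ?case unfolding dist_real_def by linarith
    qed
  qed
  from tendsto_mult_left_zero[OF this, of "norm c"]
  show ?case by (simp flip: scaleR_diff_left)
next
  case (add f g)
  show ?case
  proof (rule tendsto_sandwich[OF _ _ tendsto_const])
    show "(\<lambda>n. (LINT x|lborel. norm (f (x + t n) - f x)) + (LINT x|lborel. norm (g (x + t n) - g x))) \<longlonglongrightarrow> 0"
      using tendsto_add[OF add.IH] by simp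
    have "(LINT x|lborel. norm (f (x + t n) + g (x + t n) - (f x + g x)))
      \<le> (LINT x|lborel. norm (f (x + t n) - f x)) + (LINT x|lborel. norm (g (x + t n) - g x))" for n
    proof -
      note i = add.hyps integral_lborel_shift(1)[OF add.hyps(1), of "t n"] integral_lborel_shift(1)[OF add.hyps(2), of "t n"]
      have "(LINT x|lborel. norm (f (x + t n) + g (x + t n) - (f x + g x)))
        \<le> (LINT x|lborel. norm (f (x + t n) - f x) + norm (g (x + t n) - g x))"
        using i by (intro integral_mono norm_diff_triangle_ineq) auto
      then show ?thesis using i by simp
    qed
    then show "\<forall>\<^sub>F n in sequentially. (LINT x|lborel. norm (f (x + t n) + g (x + t n) - (f x + g x)))
      \<le> (LINT x|lborel. norm (f (x + t n) - f x)) + (LINT x|lborel. norm (g (x + t n) - g x))" by simp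
  qed simp
next
  case (lim f s)
  note si = lim.hyps(1)
  have fi: "integrable lborel f" by (rule lim.hyps)
  have conv: "(\<lambda>i. LINT x|lborel. norm (f x - s i x)) \<longlonglongrightarrow> (LINT x|(lborel::'a measure). (0::real))"
  proof (rule integral_dominated_convergence[where w="\<lambda>x. 3 * norm (f x)"])
    show "AE x in lborel. (\<lambda>i. norm (f x - s i x)) \<longlonglongrightarrow> 0"
      using lim.hyps(2) by (auto simp: tendsto_norm_zero_iff intro!: AE_I2 tendsto_eq_intros)
    show "AE x in lborel. norm (norm (f x - s i x)) \<le> 3 * norm (f x)" for i
      using lim.hyps(3)[of _ i] by (auto intro!: order_trans[OF norm_triangle_ineq4])
  qed (use si fi in auto)
  show ?case
  proof (rule tendstoI)
    fix e :: real assume "e > 0"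
    then have "\<forall>\<^sub>F i in sequentially. (LINT x|lborel. norm (f x - s i x)) < e / 3"
      using order_tendstoD(2)[OF conv, of "e/3"] by simp
    then obtain i where i: "(LINT x|lborel. norm (f x - s i x)) < e / 3"
      by (auto simp: eventually_sequentially)
    have bd: "(LINT x|lborel. norm (f (x + t n) - f x))
       \<le> (LINT x|lborel. norm (s i (x + t n) - s i x)) + 2 * (LINT x|lborel. norm (f x - s i x))" for n
    proof -
      note j1 = integral_lborel_shift(1)[OF si, of i "t n"] and j2 = integral_lborel_shift(1)[OF fi, of "t n"]
      have d: "integrable lborel (\<lambda>x. norm (f x - s i x))" using si fi by auto
      note j3 = integral_lborel_shift(1,2)[OF d, of "t n"]
      have "(LINT x|lborel. norm (f (x + t n) - f x))
        \<le> (LINT x|lborel. norm (s i (x + t n) - s i x) + norm (f (x + t n) - s i (x + t n)) + norm (f x - s i x))"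
      proof (rule integral_mono)
        fix x
        show "norm (f (x + t n) - f x) \<le> norm (s i (x + t n) - s i x) + norm (f (x + t n) - s i (x + t n)) + norm (f x - s i x)"
          by norm
      qed (use j1 j2 j3 d si fi in auto)
      also have "\<dots> = (LINT x|lborel. norm (s i (x + t n) - s i x)) + 2 * (LINT x|lborel. norm (f x - s i x))"
        using j1 j2 j3 d si fi by simp
      finally show ?thesis .
    qed
    have "\<forall>\<^sub>F n in sequentially. (LINT x|lborel. norm (s i (x + t n) - s i x)) < e / 3"
      using order_tendstoD(2)[OF lim.IH[of i], of "e/3"] \<open>e > 0\<close> by simp
    then show "\<forall>\<^sub>F n in sequentially. dist (LINT x|lborel. norm (f (x + t n) - f x)) 0 < e"
    proof eventually_elim
      case (elim n)
      have "(LINT x|lborel. norm (f (x + t n) - f x)) \<ge> 0" by simp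
      with elim bd[of n] i show ?case unfolding dist_real_def by linarith
    qed
  qed
qed

definition gauss :: "real \<Rightarrow> 'a::euclidean_space \<Rightarrow> real" where
  "gauss e x = exp (- (norm x)\<^sup>2 / (2 * e)) / sqrt (2 * pi * e) ^ DIM('a)"

definition gconv :: "real \<Rightarrow> ('a::euclidean_space \<Rightarrow> 'b::{banach,second_countable_topology}) \<Rightarrow> 'a \<Rightarrow> 'b" where
  "gconv e f a = (LINT x|lborel. gauss e (x - a) *\<^sub>R f x)"

lemma gauss_measurable [measurable]: "gauss e \<in> borel_measurable borel"
  unfolding gauss_def by measurable

lemma gauss_nonneg [simp]: "e > 0 \<Longrightarrow> gauss e x \<ge> 0"
  by (simp add: gauss_def)

lemma gauss_le: "e > 0 \<Longrightarrow> gauss e (x::'a::euclidean_space) \<le> 1 / sqrt (2 * pi * e) ^ DIM('a)"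
  unfolding gauss_def by (intro divide_right_mono) auto

lemma gauss_commute: "gauss e (x - y) = gauss e (y - x)"
  by (simp add: gauss_def norm_minus_commute)

lemma has_integral_gauss:
  fixes a :: "'a::euclidean_space"
  assumes "e > 0"
  shows "integrable lborel (gauss e :: 'a \<Rightarrow> real)" "(LINT x|lborel. gauss e (x::'a)) = 1"
    "integrable lborel (\<lambda>x. gauss e (x - a))" "(LINT x|lborel. gauss e (x - a)) = 1"
proof -
  have z: "Re (of_real (1 / e)) > 0" using assms by simp
  have "exp (- of_real (1 / e) * of_real ((norm x)\<^sup>2) / 2) * cis (- (0 \<bullet> x)) = of_real (exp (- (norm x)\<^sup>2 / (2 * e)))" for x :: 'a
    by (simp add: mult.commute flip: exp_of_real)
  note g = gaussian_ft[OF z, of "0::'a", unfolded this]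
  have "csqrt (of_real (2 * pi) / of_real (1 / e)) = of_real (sqrt (2 * pi * e))"
    using assms of_real_sqrt[of "2 * pi * e"] by simp
  with g(2) have "complex_of_real (LINT x|lborel. exp (- (norm (x::'a))\<^sup>2 / (2 * e))) = of_real (sqrt (2 * pi * e) ^ DIM('a))"
    by simp
  then have "(LINT x|lborel. exp (- (norm (x::'a))\<^sup>2 / (2 * e))) = sqrt (2 * pi * e) ^ DIM('a)"
    by (simp only: of_real_eq_iff)
  then show 2: "(LINT x|lborel. gauss e (x::'a)) = 1"
    using assms by (simp add: gauss_def)
  have "integrable lborel (\<lambda>x::'a. exp (- (norm x)\<^sup>2 / (2 * e)))"
    using g(1) by (simp only: integrable_of_real complex_of_real_integrable_eq)
  then show 1: "integrable lborel (gauss e :: 'a \<Rightarrow> real)"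
    unfolding gauss_def by (rule integrable_divide)
  show "integrable lborel (\<lambda>x. gauss e (x - a))" "(LINT x|lborel. gauss e (x - a)) = 1"
    using integral_lborel_shift(3,4)[OF 1, of a] 2 by auto
qed

lemma integrable_gauss_mult:
  fixes f :: "'a::euclidean_space \<Rightarrow> 'b::{banach,second_countable_topology}"
  assumes "e > 0" "integrable lborel f"
  shows "integrable lborel (\<lambda>x. gauss e (x - a) *\<^sub>R f x)"
proof (rule Bochner_Integration.integrable_bound[of _ "\<lambda>x. 1 / sqrt (2 * pi * e) ^ DIM('a) * norm (f x)"])
  show "AE x in lborel. norm (gauss e (x - a) *\<^sub>R f x) \<le> norm (1 / sqrt (2 * pi * e) ^ DIM('a) * norm (f x))"
    using mult_right_mono[OF gauss_le[OF assms(1)] norm_ge_zero] assms(1) by (auto simp: abs_mult intro!: AE_I2)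
qed (use assms(2) in auto)

lemma integrable_gauss_mult_bounded:
  fixes f :: "'a::euclidean_space \<Rightarrow> 'b::{banach,second_countable_topology}"
  assumes "e > 0" "f \<in> borel_measurable borel" "\<And>x. norm (f x) \<le> B"
  shows "integrable lborel (\<lambda>x. gauss e (x - a) *\<^sub>R f x)"
    "norm (gconv e f a) \<le> B"
proof -
  have i: "integrable lborel (\<lambda>x. gauss e (x - a) * B)"
    using has_integral_gauss(3)[OF assms(1), of a] by simp
  have b: "norm (gauss e (x - a) *\<^sub>R f x) \<le> gauss e (x - a) * B" for x
    using assms(1,3) by (auto intro!: mult_left_mono)
  show *: "integrable lborel (\<lambda>x. gauss e (x - a) *\<^sub>R f x)"
    using assms(2) b by (intro Bochner_Integration.integrable_bound[OF i]) (auto intro!: AE_I2 order_trans[OF _ abs_ge_self])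
  have "norm (gconv e f a) \<le> (LINT x|lborel. gauss e (x - a) * B)"
    unfolding gconv_def by (rule Bochner_Integration.integral_norm_bound_integral[OF * i b])
  then show "norm (gconv e f a) \<le> B" using has_integral_gauss(4)[OF assms(1), of a] by simp
qed

lemma gconv_measurable [measurable]:
  assumes [measurable]: "f \<in> borel_measurable borel"
  shows "gconv e f \<in> borel_measurable borel"
  unfolding gconv_def by measurable

lemma gconv_eq_scaled:
  fixes f :: "'a::euclidean_space \<Rightarrow> 'b::{banach,second_countable_topology}"
  assumes "e > 0" and [measurable]: "f \<in> borel_measurable borel"
  shows "gconv e f a = (LINT s|lborel. gauss 1 s *\<^sub>R f (a + sqrt e *\<^sub>R s))"
proof -
  have "sqrt e ^ DIM('a) * gauss e (sqrt e *\<^sub>R s) = gauss 1 s" for s :: 'a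
    using assms by (simp add: gauss_def power_mult_distrib real_sqrt_mult)
  moreover have "gconv e f a = \<bar>sqrt e\<bar> ^ DIM('a) *\<^sub>R (LINT s|lborel. gauss e (a + sqrt e *\<^sub>R s - a) *\<^sub>R f (a + sqrt e *\<^sub>R s))"
    unfolding gconv_def using assms by (subst integral_lborel_affine(1)[where c="sqrt e" and t=a]) auto
  ultimately show ?thesis using assms by (simp flip: integral_scaleR_right)
qed

lemma integrable_pair_shift:
  fixes f :: "'a::euclidean_space \<Rightarrow> 'b::{banach,second_countable_topology}" and k :: "'a \<Rightarrow> real"
  assumes k: "integrable lborel k" and f: "integrable lborel f"
  shows "integrable (lborel \<Otimes>\<^sub>M lborel) (\<lambda>(s, a). k s *\<^sub>R f (a + c *\<^sub>R s))"
proof (rule lborel_pair.Fubini_integrable)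
  have [measurable]: "k \<in> borel_measurable borel" "f \<in> borel_measurable borel" using k f by auto
  show "(\<lambda>(s, a). k s *\<^sub>R f (a + c *\<^sub>R s)) \<in> borel_measurable (lborel \<Otimes>\<^sub>M lborel)"
    by (simp add: case_prod_unfold)
  note sh = integral_lborel_shift[OF f] integral_lborel_shift[OF integrable_norm[OF f]]
  have "(LINT a|lborel. norm (case (s, a) of (s, a) \<Rightarrow> k s *\<^sub>R f (a + c *\<^sub>R s))) = norm (k s) * (LINT a|lborel. norm (f a))" for s
    by (simp add: sh)
  then have "(\<lambda>s. LINT a|lborel. norm (case (s, a) of (s, a) \<Rightarrow> k s *\<^sub>R f (a + c *\<^sub>R s)))
      = (\<lambda>s. norm (k s) * (LINT a|lborel. norm (f a)))" by (rule ext)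
  then show "integrable lborel (\<lambda>s. LINT a|lborel. norm (case (s, a) of (s, a) \<Rightarrow> k s *\<^sub>R f (a + c *\<^sub>R s)))"
    using k by (simp only:) auto
  show "AE s in lborel. integrable lborel (\<lambda>a. case (s, a) of (s, a) \<Rightarrow> k s *\<^sub>R f (a + c *\<^sub>R s))"
    by (simp add: sh)
qed

lemma gconv_tendsto_L1:
  fixes f :: "'a::euclidean_space \<Rightarrow> 'b::{banach,second_countable_topology}"
  assumes f: "integrable lborel f" and e: "\<And>n. e n > 0" "e \<longlonglongrightarrow> 0"
  shows "\<And>n. integrable lborel (gconv (e n) f)"
    and "(\<lambda>n. LINT a|lborel. norm (gconv (e n) f a - f a)) \<longlonglongrightarrow> 0"
proof -
  have [measurable]: "f \<in> borel_measurable borel" using f by auto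
  have g: "integrable lborel (gauss 1 :: 'a \<Rightarrow> real)" "(LINT s|lborel. gauss 1 (s::'a)) = 1"
    by (rule has_integral_gauss; simp)+
  define H where "H = (\<lambda>n (s, a). gauss 1 s *\<^sub>R f (a + sqrt (e n) *\<^sub>R s))"
  define H0 where "H0 = (\<lambda>(s::'a, a). gauss 1 s *\<^sub>R f a)"
  have H: "integrable (lborel \<Otimes>\<^sub>M lborel) (H n)" for n
    unfolding H_def by (rule integrable_pair_shift[OF g(1) f])
  have H0: "integrable (lborel \<Otimes>\<^sub>M lborel) H0"
    unfolding H0_def using integrable_pair_shift[OF g(1) f, of 0] by simp
  have geq: "gconv (e n) f a = (LINT s|lborel. H n (s, a))" for n a
    using gconv_eq_scaled[OF e(1), of f n a] by (simp add: H_def)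
  have feq: "f a = (LINT s|lborel. H0 (s, a))" for a
    using g by (simp add: H0_def)
  show gi: "integrable lborel (gconv (e n) f)" for n
    using lborel_pair.integrable_snd[of "\<lambda>s a. H n (s, a)"] H by (simp add: geq[abs_def])
  define \<omega> where "\<omega> = (\<lambda>n (s::'a). LINT a|lborel. norm (f (a + sqrt (e n) *\<^sub>R s) - f a))"
  have D: "integrable (lborel \<Otimes>\<^sub>M lborel) (\<lambda>p. norm (H n p - H0 p))" for n
    using H H0 by auto
  have bd: "(LINT a|lborel. norm (gconv (e n) f a - f a)) \<le> (LINT s|lborel. gauss 1 s * \<omega> n s)" for n
  proof -
    have "(LINT a|lborel. norm (gconv (e n) f a - f a)) \<le> (LINT a|lborel. (LINT s|lborel. norm (H n (s, a) - H0 (s, a))))"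
    proof (rule integral_mono_AE)
      show "integrable lborel (\<lambda>a. norm (gconv (e n) f a - f a))" using gi f by auto
      show "integrable lborel (\<lambda>a. LINT s|lborel. norm (H n (s, a) - H0 (s, a)))"
        using lborel_pair.integrable_snd[of "\<lambda>s a. norm (H n (s, a) - H0 (s, a))"] D by (simp add: case_prod_unfold)
      have 1: "AE a in lborel. integrable lborel (\<lambda>s. H n (s, a))"
        using lborel_pair.AE_integrable_snd[of "\<lambda>s a. H n (s, a)"] H by simp
      have 2: "integrable lborel (\<lambda>s. H0 (s, a))" for a
        using g by (simp add: H0_def)
      from 1 show "AE a in lborel. norm (gconv (e n) f a - f a) \<le> (LINT s|lborel. norm (H n (s, a) - H0 (s, a)))"
      proof (eventually_elim)
        case (elim a)
        then have "gconv (e n) f a - f a = (LINT s|lborel. H n (s, a) - H0 (s, a))"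
          unfolding geq feq[of a] using 2[of a] by simp
        then show ?case by simp
      qed
    qed
    also have "\<dots> = (LINT s|lborel. (LINT a|lborel. norm (H n (s, a) - H0 (s, a))))"
      using lborel_pair.Fubini_integral[of "\<lambda>s a. norm (H n (s, a) - H0 (s, a))"] D by (simp add: case_prod_unfold)
    also have "\<dots> = (LINT s|lborel. gauss 1 s * \<omega> n s)"
      by (intro Bochner_Integration.integral_cong refl)
         (simp add: H_def H0_def \<omega>_def flip: scaleR_diff_right)
    finally show ?thesis .
  qed
  have \<omega>_le: "\<bar>\<omega> n s\<bar> \<le> 2 * (LINT a|lborel. norm (f a))" for n s
  proof -
    note sh = integral_lborel_shift[OF f, of "sqrt (e n) *\<^sub>R s"] integral_lborel_shift[OF integrable_norm[OF f], of "sqrt (e n) *\<^sub>R s"]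
    have "\<omega> n s \<le> (LINT a|lborel. norm (f (a + sqrt (e n) *\<^sub>R s)) + norm (f a))"
      unfolding \<omega>_def using sh f by (intro integral_mono) (auto intro!: norm_triangle_ineq4)
    also have "\<dots> = 2 * (LINT a|lborel. norm (f a))" using sh f by simp
    finally show ?thesis by (simp add: \<omega>_def)
  qed
  have "(\<lambda>n. LINT s|lborel. gauss 1 s * \<omega> n s) \<longlonglongrightarrow> (LINT s|(lborel::'a measure). (0::real))"
  proof (rule integral_dominated_convergence[where w="\<lambda>s. gauss 1 s * (2 * (LINT a|lborel. norm (f a)))"])
    show "(\<lambda>s. gauss 1 s * \<omega> n s) \<in> borel_measurable lborel" for n
      unfolding \<omega>_def by measurable
    show "integrable lborel (\<lambda>s::'a. gauss 1 s * (2 * (LINT a|lborel. norm (f a))))" using g by simp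
    show "AE s in lborel. (\<lambda>n. gauss 1 s * \<omega> n s) \<longlonglongrightarrow> 0"
    proof (rule AE_I2)
      fix s :: 'a
      have "(\<lambda>n. sqrt (e n) *\<^sub>R s) \<longlonglongrightarrow> sqrt 0 *\<^sub>R s" by (intro tendsto_intros e)
      then have "(\<lambda>n. \<omega> n s) \<longlonglongrightarrow> 0"
        unfolding \<omega>_def by (intro translation_tendsto_L1[OF f]) simp
      then show "(\<lambda>n. gauss 1 s * \<omega> n s) \<longlonglongrightarrow> 0" by (rule tendsto_mult_right_zero)
    qed
    show "AE s in lborel. norm (gauss 1 s * \<omega> n s) \<le> gauss 1 s * (2 * (LINT a|lborel. norm (f a)))" for n
      using \<omega>_le by (auto simp: abs_mult intro!: AE_I2 mult_left_mono)
  qed simp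
  then have lim0: "(\<lambda>n. LINT s|lborel. gauss 1 s * \<omega> n s) \<longlonglongrightarrow> 0" by simp
  show "(\<lambda>n. LINT a|lborel. norm (gconv (e n) f a - f a)) \<longlonglongrightarrow> 0"
    by (rule tendsto_sandwich[OF _ _ tendsto_const lim0]) (auto intro!: always_eventually bd)
qed

lemma gconv_norm_sq_le:
  fixes f :: "'a::euclidean_space \<Rightarrow> 'b::{banach,second_countable_topology}"
  assumes e: "e > 0" and [measurable]: "f \<in> borel_measurable borel"
    and i2: "integrable lborel (\<lambda>x. gauss e (x - a) *\<^sub>R (norm (f x))\<^sup>2)"
  shows "(norm (gconv e f a))\<^sup>2 \<le> gconv e (\<lambda>x. (norm (f x))\<^sup>2) a"
    and "integrable lborel (\<lambda>x. gauss e (x - a) *\<^sub>R f x)"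
proof -
  note g = has_integral_gauss(3,4)[OF e, of a]
  have le: "t \<le> 1 + t\<^sup>2" for t :: real
    using zero_le_power2[of "t - 1/2"] by (simp add: power2_eq_square algebra_simps)
  have "gauss e (x - a) * norm (f x) \<le> gauss e (x - a) + gauss e (x - a) * (norm (f x))\<^sup>2" for x
    using mult_left_mono[OF le[of "norm (f x)"] gauss_nonneg[OF e, of "x - a"]] by (simp add: distrib_left)
  then have i1: "integrable lborel (\<lambda>x. gauss e (x - a) * norm (f x))"
    by (intro Bochner_Integration.integrable_bound[OF Bochner_Integration.integrable_add[OF g(1) i2]])
      (use e in \<open>auto intro!: AE_I2 simp: abs_mult\<close>)
  then show "integrable lborel (\<lambda>x. gauss e (x - a) *\<^sub>R f x)"
    by (rule Bochner_Integration.integrable_bound) (use e in \<open>auto simp: abs_mult\<close>)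
  define m where "m = (LINT x|lborel. gauss e (x - a) * norm (f x))"
  have "0 \<le> (LINT x|lborel. gauss e (x - a) * (norm (f x) - m)\<^sup>2)" using e by simp
  also have "\<dots> = (LINT x|lborel. gauss e (x - a) *\<^sub>R (norm (f x))\<^sup>2 - 2 * m * (gauss e (x - a) * norm (f x)) + m\<^sup>2 * gauss e (x - a))"
    by (intro Bochner_Integration.integral_cong) (auto simp: power2_diff algebra_simps)
  also have "\<dots> = gconv e (\<lambda>x. (norm (f x))\<^sup>2) a - 2 * m * m + m\<^sup>2 * 1"
    unfolding gconv_def m_def using i1 i2 g by simp
  finally have "m\<^sup>2 \<le> gconv e (\<lambda>x. (norm (f x))\<^sup>2) a" by (simp add: power2_eq_square)
  moreover have "norm (gconv e f a) \<le> m"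
    unfolding gconv_def m_def using e by (rule_tac order_trans[OF integral_norm_bound]) simp
  ultimately show "(norm (gconv e f a))\<^sup>2 \<le> gconv e (\<lambda>x. (norm (f x))\<^sup>2) a"
    by (meson norm_ge_zero order_trans power_mono)
qed

lemma gconv_symmetric:
  fixes f A :: "'a::euclidean_space \<Rightarrow> 'b::{real_normed_field,banach,second_countable_topology}"
  assumes e: "e > 0" and f: "integrable lborel f" and [measurable]: "A \<in> borel_measurable borel"
    and A: "\<And>x. integrable lborel (\<lambda>a. gauss e (a - x) *\<^sub>R A a)" "\<And>x. gconv e (\<lambda>a. norm (A a)) x \<le> B"
  shows "(LINT a|lborel. A a * gconv e f a) = (LINT x|lborel. gconv e A x * f x)"
proof -
  have [measurable]: "f \<in> borel_measurable borel" using f by auto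
  have g0: "gconv e (\<lambda>a. norm (A a)) x \<ge> 0" for x unfolding gconv_def using e by simp
  have I: "integrable (lborel \<Otimes>\<^sub>M lborel) (\<lambda>(x, a). gauss e (a - x) *\<^sub>R (A a * f x))"
  proof (rule lborel_pair.Fubini_integrable)
    show "(\<lambda>(x, a). gauss e (a - x) *\<^sub>R (A a * f x)) \<in> borel_measurable (lborel \<Otimes>\<^sub>M lborel)"
      by (simp add: case_prod_unfold)
    have "(LINT a|lborel. norm (case (x, a) of (x, a) \<Rightarrow> gauss e (a - x) *\<^sub>R (A a * f x)))
       = gconv e (\<lambda>a. norm (A a)) x * norm (f x)" for x
      using e by (simp add: gconv_def norm_mult flip: integral_mult_left_zero mult.assoc)
    moreover have "integrable lborel (\<lambda>x. gconv e (\<lambda>a. norm (A a)) x * norm (f x))"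
      by (rule Bochner_Integration.integrable_bound[of _ "\<lambda>x. B * norm (f x)"])
         (use f A(2) g0 in \<open>auto intro!: AE_I2 mult_right_mono order_trans[OF _ abs_ge_self] simp: abs_mult\<close>)
    ultimately show "integrable lborel (\<lambda>x. LINT a|lborel. norm (case (x, a) of (x, a) \<Rightarrow> gauss e (a - x) *\<^sub>R (A a * f x)))"
      by simp
    show "AE x in lborel. integrable lborel (\<lambda>a. case (x, a) of (x, a) \<Rightarrow> gauss e (a - x) *\<^sub>R (A a * f x))"
      using A(1) integrable_mult_left by (auto simp: simp flip: mult_scaleR_left)
  qed
  have "(LINT a|lborel. A a * gconv e f a) = (LINT a|lborel. (LINT x|lborel. gauss e (a - x) *\<^sub>R (A a * f x)))"
    by (intro Bochner_Integration.integral_cong refl)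
       (simp add: gconv_def gauss_commute flip: integral_mult_right_zero)
  also have "\<dots> = (LINT x|lborel. (LINT a|lborel. gauss e (a - x) *\<^sub>R (A a * f x)))"
    by (rule lborel_pair.Fubini_integral[OF I])
  also have "\<dots> = (LINT x|lborel. gconv e A x * f x)"
    by (intro Bochner_Integration.integral_cong refl)
       (simp add: gconv_def flip: integral_mult_left_zero)
  finally show ?thesis .
qed

section \<open>The Fourier transform of integrable functions\<close>

lemma tendsto_integral_mult_gconv:
  fixes f A :: "'a::euclidean_space \<Rightarrow> 'b::{real_normed_field,banach,second_countable_topology}"
  assumes f: "integrable lborel f" and e: "\<And>n. e n > 0" "e \<longlonglongrightarrow> 0"
    and [measurable]: "A \<in> borel_measurable borel" and A: "\<And>x. norm (A x) \<le> B"
  shows "(\<lambda>n. LINT a|lborel. A a * gconv (e n) f a) \<longlonglongrightarrow> (LINT a|lborel. A a * f a)"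
proof -
  note g = gconv_tendsto_L1[OF f e]
  have iA: "integrable lborel (\<lambda>a. A a * h a)" if h: "integrable lborel h" for h :: "'a \<Rightarrow> 'b"
  proof (rule Bochner_Integration.integrable_bound[of _ "\<lambda>a. B * norm (h a)"])
    show "(\<lambda>a. A a * h a) \<in> borel_measurable lborel"
      using borel_measurable_integrable[OF h] by simp
    show "AE a in lborel. norm (A a * h a) \<le> norm (B * norm (h a))"
      using A order_trans[OF norm_ge_zero A]
      by (auto simp: norm_mult abs_mult intro!: AE_I2 mult_right_mono)
  qed (use h in auto)
  have bd: "norm ((LINT a|lborel. A a * gconv (e n) f a) - (LINT a|lborel. A a * f a))
      \<le> B * (LINT a|lborel. norm (gconv (e n) f a - f a))" for n
  proof -
    have "(LINT a|lborel. A a * gconv (e n) f a) - (LINT a|lborel. A a * f a)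
        = (LINT a|lborel. A a * (gconv (e n) f a - f a))"
      unfolding right_diff_distrib by (rule Bochner_Integration.integral_diff[symmetric]) (intro iA g f)+
    also have "norm \<dots> \<le> (LINT a|lborel. B * norm (gconv (e n) f a - f a))"
    proof (rule Bochner_Integration.integral_norm_bound_integral)
      have d: "integrable lborel (\<lambda>a. gconv (e n) f a - f a)" by (intro Bochner_Integration.integrable_diff g f)
      show "integrable lborel (\<lambda>a. A a * (gconv (e n) f a - f a))" by (rule iA[OF d])
      show "integrable lborel (\<lambda>a. B * norm (gconv (e n) f a - f a))" using d by simp
    qed (auto simp: norm_mult intro!: mult_right_mono A)
    finally show ?thesis by simp
  qed
  have "(\<lambda>n. B * (LINT a|lborel. norm (gconv (e n) f a - f a))) \<longlonglongrightarrow> 0"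
    by (rule tendsto_mult_right_zero[OF g(2)])
  then have "(\<lambda>n. (LINT a|lborel. A a * gconv (e n) f a) - (LINT a|lborel. A a * f a)) \<longlonglongrightarrow> 0"
    by (rule Lim_null_comparison[OF always_eventually[OF allI[OF bd]]])
  then show ?thesis by (rule LIM_zero_cancel)
qed

definition ft :: "('a::euclidean_space \<Rightarrow> complex) \<Rightarrow> 'a \<Rightarrow> complex" where
  "ft f \<xi> = (LINT x|lborel. cis (- (\<xi> \<bullet> x)) * f x)"

lemma cis_measurable [measurable]:
  "f \<in> borel_measurable M \<Longrightarrow> (\<lambda>x. cis (f x)) \<in> borel_measurable M"
  unfolding cis_conv_exp by measurable

lemma cnj_measurable [measurable]:
  "f \<in> borel_measurable M \<Longrightarrow> (\<lambda>x. cnj (f x)) \<in> borel_measurable M"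
  by (rule borel_measurable_continuous_on[where f=cnj]) (auto intro: continuous_intros)

lemma integrable_cis_mult:
  fixes f :: "'a \<Rightarrow> complex"
  assumes "integrable M f" "\<theta> \<in> borel_measurable M"
  shows "integrable M (\<lambda>x. cis (\<theta> x) * f x)"
  by (rule Bochner_Integration.integrable_bound[OF assms(1)])
    (use assms in \<open>auto simp: norm_mult\<close>)

lemma ft_measurable [measurable]:
  assumes [measurable]: "f \<in> borel_measurable borel"
  shows "ft f \<in> borel_measurable borel"
  unfolding ft_def by measurable

lemma norm_ft_le: "cmod (ft f \<xi>) \<le> (LINT x|lborel. cmod (f x))"
  unfolding ft_def by (rule order_trans[OF integral_norm_bound]) (simp add: norm_mult)

lemma ft_mult_formula:
  fixes A B :: "'a::euclidean_space \<Rightarrow> complex"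
  assumes A: "integrable lborel A" and B: "integrable lborel B"
  shows "(LINT \<xi>|lborel. ft A \<xi> * B \<xi>) = (LINT x|lborel. A x * ft B x)"
proof -
  have [measurable]: "A \<in> borel_measurable borel" "B \<in> borel_measurable borel" using A B by auto
  have I: "integrable (lborel \<Otimes>\<^sub>M lborel) (\<lambda>(x, y). cis (- (x \<bullet> y)) * (A x * B y))"
  proof (rule lborel_pair.Fubini_integrable)
    show "(\<lambda>(x, y). cis (- (x \<bullet> y)) * (A x * B y)) \<in> borel_measurable (lborel \<Otimes>\<^sub>M lborel)"
      by (simp add: case_prod_unfold)
    show "integrable lborel (\<lambda>x. LINT y|lborel. norm (case (x, y) of (x, y) \<Rightarrow> cis (- (x \<bullet> y)) * (A x * B y)))"
      using A by (simp add: norm_mult)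
    show "AE x in lborel. integrable lborel (\<lambda>y. case (x, y) of (x, y) \<Rightarrow> cis (- (x \<bullet> y)) * (A x * B y))"
      using B by (auto intro!: AE_I2 integrable_cis_mult)
  qed
  have "(LINT \<xi>|lborel. ft A \<xi> * B \<xi>) = (LINT y|lborel. (LINT x|lborel. cis (- (x \<bullet> y)) * (A x * B y)))"
    by (intro Bochner_Integration.integral_cong refl)
       (simp add: ft_def inner_commute mult.assoc flip: integral_mult_left_zero)
  also have "\<dots> = (LINT x|lborel. (LINT y|lborel. cis (- (x \<bullet> y)) * (A x * B y)))"
    by (rule lborel_pair.Fubini_integral[OF I])
  also have "\<dots> = (LINT x|lborel. A x * ft B x)"
    by (intro Bochner_Integration.integral_cong refl)
       (simp add: ft_def mult.left_commute flip: integral_mult_right_zero)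
  finally show ?thesis .
qed

lemma ft_convolution:
  fixes A B :: "'a::euclidean_space \<Rightarrow> complex"
  assumes A: "integrable lborel A" and B: "integrable lborel B"
  defines "C \<equiv> \<lambda>x. LINT y|lborel. A (x - y) * B y"
  shows "integrable lborel C" "ft C \<xi> = ft A \<xi> * ft B \<xi>"
proof -
  have [measurable]: "A \<in> borel_measurable borel" "B \<in> borel_measurable borel" using A B by auto
  note shA = integral_lborel_shift[OF A] integral_lborel_shift[OF integrable_norm[OF A]]
  have I: "integrable (lborel \<Otimes>\<^sub>M lborel) (\<lambda>(y, x). cis (\<theta> x) * (A (x - y) * B y))"
    if [measurable]: "\<theta> \<in> borel_measurable borel" for \<theta>
  proof (rule lborel_pair.Fubini_integrable)
    show "(\<lambda>(y, x). cis (\<theta> x) * (A (x - y) * B y)) \<in> borel_measurable (lborel \<Otimes>\<^sub>M lborel)"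
      by (simp add: case_prod_unfold)
    show "integrable lborel (\<lambda>y. LINT x|lborel. norm (case (y, x) of (y, x) \<Rightarrow> cis (\<theta> x) * (A (x - y) * B y)))"
      using B by (simp add: norm_mult shA)
    show "AE y in lborel. integrable lborel (\<lambda>x. case (y, x) of (y, x) \<Rightarrow> cis (\<theta> x) * (A (x - y) * B y))"
      using shA by (auto intro!: AE_I2 integrable_cis_mult)
  qed
  show "integrable lborel C"
    using lborel_pair.integrable_snd[OF I[of "\<lambda>_. 0"]] by (simp add: C_def)
  have "ft C \<xi> = (LINT x|lborel. (LINT y|lborel. cis (- (\<xi> \<bullet> x)) * (A (x - y) * B y)))"
    by (simp add: ft_def C_def)
  also have "\<dots> = (LINT y|lborel. (LINT x|lborel. cis (- (\<xi> \<bullet> x)) * (A (x - y) * B y)))"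
    by (rule lborel_pair.Fubini_integral[OF I]) simp
  also have "\<dots> = (LINT y|lborel. ft A \<xi> * (cis (- (\<xi> \<bullet> y)) * B y))"
  proof (intro Bochner_Integration.integral_cong refl)
    fix y
    have "(LINT x|lborel. cis (- (\<xi> \<bullet> x)) * (A (x - y) * B y))
      = (LINT x|lborel. (cis (- (\<xi> \<bullet> (x - y))) * A (x - y)) * (cis (- (\<xi> \<bullet> y)) * B y))"
      by (intro Bochner_Integration.integral_cong refl)
         (simp add: cis_mult inner_diff_right mult_ac)
    also have "\<dots> = ft A \<xi> * (cis (- (\<xi> \<bullet> y)) * B y)"
      unfolding integral_mult_left_zero ft_def
      by (subst integral_lborel_shift(4)[where f="\<lambda>x. cis (- (\<xi> \<bullet> x)) * A x"]) (auto intro!: integrable_cis_mult A)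
    finally show "(LINT x|lborel. cis (- (\<xi> \<bullet> x)) * (A (x - y) * B y)) = ft A \<xi> * (cis (- (\<xi> \<bullet> y)) * B y)" .
  qed
  also have "\<dots> = ft A \<xi> * ft B \<xi>" by (simp add: ft_def)
  finally show "ft C \<xi> = ft A \<xi> * ft B \<xi>" .
qed

lemma ft_exp_gaussian:
  fixes \<xi> :: "'a::euclidean_space"
  assumes "e > 0"
  shows "integrable lborel (\<lambda>x::'a. exp (- e * (norm x)\<^sup>2 / 2))"
    and "ft (\<lambda>x. of_real (exp (- e * (norm x)\<^sup>2 / 2))) \<xi> = of_real ((2 * pi) ^ DIM('a) * gauss e \<xi>)"
proof -
  have z: "Re (of_real e) > 0" using assms by simp
  have eq: "exp (- of_real e * of_real ((norm x)\<^sup>2) / 2) = complex_of_real (exp (- e * (norm x)\<^sup>2 / 2))" for x :: 'a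
    by (simp flip: exp_of_real)
  have "integrable lborel (\<lambda>x::'a. complex_of_real (exp (- e * (norm x)\<^sup>2 / 2)))"
    using gaussian_ft(1)[OF z, of "0::'a", unfolded eq] by simp
  then show "integrable lborel (\<lambda>x::'a. exp (- e * (norm x)\<^sup>2 / 2))"
    by (simp only: complex_of_real_integrable_eq)
  have s: "csqrt (of_real (2 * pi) / of_real e) = of_real (sqrt (2 * pi / e))"
    using assms of_real_sqrt[of "2 * pi / e"] by simp
  have "sqrt (2 * pi / e) = 2 * pi / sqrt (2 * pi * e)"
    using assms by (simp add: real_sqrt_divide real_sqrt_mult field_simps)
  then have s2: "sqrt (2 * pi / e) ^ DIM('a) = (2 * pi) ^ DIM('a) / sqrt (2 * pi * e) ^ DIM('a)"
    by (simp add: power_divide)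
  have "ft (\<lambda>x. of_real (exp (- e * (norm x)\<^sup>2 / 2))) \<xi> = of_real (sqrt (2 * pi / e) ^ DIM('a) * exp (- (norm \<xi>)\<^sup>2 / (2 * e)))"
    unfolding ft_def using gaussian_ft(2)[OF z, of \<xi>, unfolded eq s] by (simp add: mult.commute flip: exp_of_real)
  then show "ft (\<lambda>x. of_real (exp (- e * (norm x)\<^sup>2 / 2))) \<xi> = of_real ((2 * pi) ^ DIM('a) * gauss e \<xi>)"
    unfolding s2 by (simp add: gauss_def)
qed

lemma plancherel_le:
  fixes \<psi> :: "'a::euclidean_space \<Rightarrow> complex"
  assumes \<psi>: "integrable lborel \<psi>" and M: "\<And>x. cmod (\<psi> x) \<le> M"
    and F: "integrable lborel (\<lambda>\<xi>. (cmod (ft \<psi> \<xi>))\<^sup>2)"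
  shows "(2 * pi) ^ DIM('a) * (LINT x|lborel. (cmod (\<psi> x))\<^sup>2) \<le> (LINT \<xi>|lborel. (cmod (ft \<psi> \<xi>))\<^sup>2)"
proof -
  have [measurable]: "\<psi> \<in> borel_measurable borel" using \<psi> by auto
  have c\<psi>: "integrable lborel (\<lambda>x. cnj (\<psi> x))" using \<psi> by simp
  have cnj_ft: "cnj (ft \<psi> \<xi>) = ft (\<lambda>x. cnj (\<psi> x)) (- \<xi>)" for \<xi>
    unfolding ft_def Bochner_Integration.integral_cnj[symmetric]
    by (intro Bochner_Integration.integral_cong refl) (simp add: cis_cnj)
  have key: "(LINT \<xi>|lborel. of_real ((cmod (ft \<psi> \<xi>))\<^sup>2 * exp (- e * (norm \<xi>)\<^sup>2 / 2)))
     = of_real ((2 * pi) ^ DIM('a)) * (LINT x|lborel. \<psi> x * gconv e (\<lambda>x. cnj (\<psi> x)) x)" if e: "e > 0" for e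
  proof -
    let ?E = "\<lambda>\<xi>::'a. complex_of_real (exp (- e * (norm \<xi>)\<^sup>2 / 2))"
    have E: "integrable lborel ?E" using ft_exp_gaussian(1)[OF e] by (simp only: complex_of_real_integrable_eq)
    have EF: "integrable lborel (\<lambda>\<xi>. ?E \<xi> * cnj (ft \<psi> \<xi>))"
    proof (rule Bochner_Integration.integrable_bound[of _ "\<lambda>\<xi>. ?E \<xi> * of_real (LINT x|lborel. cmod (\<psi> x))"])
      show "integrable lborel (\<lambda>\<xi>. ?E \<xi> * of_real (LINT x|lborel. cmod (\<psi> x)))" using E by simp
      show "AE \<xi> in lborel. norm (?E \<xi> * cnj (ft \<psi> \<xi>)) \<le> norm (?E \<xi> * of_real (LINT x|lborel. cmod (\<psi> x)))"
        using norm_ft_le[of \<psi>] by (auto simp: norm_mult intro!: AE_I2 mult_left_mono)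
    qed simp
    have inner: "ft (\<lambda>\<xi>. ?E \<xi> * cnj (ft \<psi> \<xi>)) x = of_real ((2 * pi) ^ DIM('a)) * gconv e (\<lambda>x. cnj (\<psi> x)) x" for x
    proof -
      have "ft (\<lambda>\<xi>. ?E \<xi> * cnj (ft \<psi> \<xi>)) x = (LINT \<xi>|lborel. cis (- (x \<bullet> (0 + (-1) *\<^sub>R \<xi>))) * (?E (0 + (-1) *\<^sub>R \<xi>) * ft (\<lambda>x. cnj (\<psi> x)) (- (0 + (-1) *\<^sub>R \<xi>))))"
        unfolding cnj_ft ft_def[of "\<lambda>\<xi>. ?E \<xi> * ft (\<lambda>x. cnj (\<psi> x)) (- \<xi>)"]
        by (subst integral_lborel_affine(1)[where c="-1" and t=0]) auto
      also have "\<dots> = (LINT \<xi>|lborel. ft (\<lambda>x. cnj (\<psi> x)) \<xi> * (cis (x \<bullet> \<xi>) * ?E \<xi>))"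
        by (intro Bochner_Integration.integral_cong refl) (simp add: mult_ac)
      also have "\<dots> = (LINT y|lborel. cnj (\<psi> y) * ft (\<lambda>\<xi>. cis (x \<bullet> \<xi>) * ?E \<xi>) y)"
        by (intro ft_mult_formula c\<psi> integrable_cis_mult E) simp
      also have "\<dots> = (LINT y|lborel. of_real ((2 * pi) ^ DIM('a)) * (gauss e (y - x) *\<^sub>R cnj (\<psi> y)))"
      proof (intro Bochner_Integration.integral_cong refl)
        fix y
        have "ft (\<lambda>\<xi>. cis (x \<bullet> \<xi>) * ?E \<xi>) y = ft ?E (y - x)"
          unfolding ft_def by (intro Bochner_Integration.integral_cong refl)
            (simp add: cis_mult inner_diff_left flip: mult.assoc)
        then show "cnj (\<psi> y) * ft (\<lambda>\<xi>. cis (x \<bullet> \<xi>) * ?E \<xi>) y = of_real ((2 * pi) ^ DIM('a)) * (gauss e (y - x) *\<^sub>R cnj (\<psi> y))"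
          unfolding ft_exp_gaussian(2)[OF e] by (simp add: scaleR_conv_of_real)
      qed
      finally show ?thesis unfolding gconv_def integral_mult_right_zero .
    qed
    have "(LINT \<xi>|lborel. of_real ((cmod (ft \<psi> \<xi>))\<^sup>2 * exp (- e * (norm \<xi>)\<^sup>2 / 2)))
       = (LINT \<xi>|lborel. ft \<psi> \<xi> * (?E \<xi> * cnj (ft \<psi> \<xi>)))"
      by (intro Bochner_Integration.integral_cong refl)
         (simp add: complex_norm_square flip: of_real_power)
    also have "\<dots> = (LINT x|lborel. \<psi> x * ft (\<lambda>\<xi>. ?E \<xi> * cnj (ft \<psi> \<xi>)) x)"
      by (rule ft_mult_formula[OF \<psi> EF])
    also have "\<dots> = of_real ((2 * pi) ^ DIM('a)) * (LINT x|lborel. \<psi> x * gconv e (\<lambda>x. cnj (\<psi> x)) x)"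
      unfolding inner integral_mult_right_zero[symmetric]
      by (intro Bochner_Integration.integral_cong refl) (simp add: mult_ac)
    finally show ?thesis .
  qed
  define e where "e = (\<lambda>n. inverse (real (Suc n)))"
  have e: "\<And>n. e n > 0" "e \<longlonglongrightarrow> 0" 
    unfolding e_def by (simp, rule LIMSEQ_inverse_real_of_nat)
  have "(\<lambda>n. LINT x|lborel. \<psi> x * gconv (e n) (\<lambda>x. cnj (\<psi> x)) x) \<longlonglongrightarrow> (LINT x|lborel. \<psi> x * cnj (\<psi> x))"
    by (rule tendsto_integral_mult_gconv[OF c\<psi> e]) (auto intro: M)
  also have "(LINT x|lborel. \<psi> x * cnj (\<psi> x)) = of_real (LINT x|lborel. (cmod (\<psi> x))\<^sup>2)"
    unfolding complex_norm_square[symmetric] by (rule integral_complex_of_real)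
  finally have lim: "(\<lambda>n. Re (of_real ((2 * pi) ^ DIM('a)) * (LINT x|lborel. \<psi> x * gconv (e n) (\<lambda>x. cnj (\<psi> x)) x)))
      \<longlonglongrightarrow> Re (of_real ((2 * pi) ^ DIM('a)) * of_real (LINT x|lborel. (cmod (\<psi> x))\<^sup>2))"
    by (intro tendsto_Re tendsto_mult tendsto_const)
  have "Re (of_real ((2 * pi) ^ DIM('a)) * (LINT x|lborel. \<psi> x * gconv (e n) (\<lambda>x. cnj (\<psi> x)) x))
      \<le> (LINT \<xi>|lborel. (cmod (ft \<psi> \<xi>))\<^sup>2)" for n
  proof -
    have en: "exp (- e n * (norm \<xi>)\<^sup>2 / 2) \<le> 1" for \<xi> :: 'a using e(1)[of n] by simp
    have "(LINT \<xi>|lborel. (cmod (ft \<psi> \<xi>))\<^sup>2 * exp (- e n * (norm \<xi>)\<^sup>2 / 2)) \<le> (LINT \<xi>|lborel. (cmod (ft \<psi> \<xi>))\<^sup>2)"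
    proof (rule integral_mono)
      show b: "(cmod (ft \<psi> \<xi>))\<^sup>2 * exp (- e n * (norm \<xi>)\<^sup>2 / 2) \<le> (cmod (ft \<psi> \<xi>))\<^sup>2" for \<xi>
        using mult_left_mono[OF en, of "(cmod (ft \<psi> \<xi>))\<^sup>2" \<xi>] by simp
      show "integrable lborel (\<lambda>\<xi>. (cmod (ft \<psi> \<xi>))\<^sup>2 * exp (- e n * (norm \<xi>)\<^sup>2 / 2))"
        by (rule Bochner_Integration.integrable_bound[OF F]) (use b in \<open>auto intro!: AE_I2\<close>)
    qed (rule F)
    then show ?thesis unfolding key[OF e(1), symmetric] integral_complex_of_real Re_complex_of_real .
  qed
  then have "Re (of_real ((2 * pi) ^ DIM('a)) * of_real (LINT x|lborel. (cmod (\<psi> x))\<^sup>2)) \<le> (LINT \<xi>|lborel. (cmod (ft \<psi> \<xi>))\<^sup>2)"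
    by (intro LIMSEQ_le_const2[OF lim]) auto
  then show ?thesis by simp
qed

section \<open>Testing the distributional identities with Gaussians\<close>

lemma fourier_eq_ft:
  fixes f :: "'a::euclidean_space \<Rightarrow> complex"
  assumes [measurable]: "f \<in> borel_measurable borel"
  shows "fourier f \<xi> = of_real ((2 * pi) powr (- real DIM('a) / 2)) * ft f \<xi>"
    and "fourier_inv f \<xi> = of_real ((2 * pi) powr (- real DIM('a) / 2)) * ft f (- \<xi>)"
proof -
  have "(LINT x|lebesgue. exp (- \<i> * of_real (\<xi> \<bullet> x)) * f x) = ft f \<xi>"
    unfolding ft_def by (subst integral_completion) (auto simp: cis_conv_exp)
  then show "fourier f \<xi> = of_real ((2 * pi) powr (- real DIM('a) / 2)) * ft f \<xi>"
    by (simp add: fourier_def)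
  have "(LINT x|lebesgue. exp (\<i> * of_real (x \<bullet> \<xi>)) * f x) = ft f (- \<xi>)"
    unfolding ft_def by (subst integral_completion) (auto simp: cis_conv_exp inner_commute)
  then show "fourier_inv f \<xi> = of_real ((2 * pi) powr (- real DIM('a) / 2)) * ft f (- \<xi>)"
    by (simp add: fourier_inv_def)
qed

lemma two_pi_powr_half_sq: "((2 * pi) powr (- real d / 2))\<^sup>2 = 1 / (2 * pi) ^ d"
proof -
  have "((2 * pi) powr (- real d / 2))\<^sup>2 = (2 * pi) powr (- real d)"
    unfolding power2_eq_square powr_add[symmetric] by (rule arg_cong[where f="(powr) (2 * pi)"]) simp
  also have "\<dots> = inverse ((2 * pi) ^ d)"
    unfolding powr_minus by (subst powr_realpow) auto
  finally show ?thesis by (simp only: divide_inverse mult_1_left)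
qed

lemma ft_shift:
  fixes f :: "'a::euclidean_space \<Rightarrow> complex"
  assumes [measurable]: "f \<in> borel_measurable borel"
  shows "ft (\<lambda>x. f (x - a)) \<xi> = cis (- (\<xi> \<bullet> a)) * ft f \<xi>"
proof -
  have "ft (\<lambda>x. f (x - a)) \<xi> = (LINT x|lborel. cis (- (\<xi> \<bullet> (a + 1 *\<^sub>R x))) * f (a + 1 *\<^sub>R x - a))"
    unfolding ft_def by (subst integral_lborel_affine(1)[where c=1 and t=a]) auto
  also have "\<dots> = (LINT x|lborel. cis (- (\<xi> \<bullet> a)) * (cis (- (\<xi> \<bullet> x)) * f x))"
    by (intro Bochner_Integration.integral_cong refl) (simp add: inner_add_right cis_mult flip: mult.assoc)
  finally show ?thesis by (simp add: ft_def)
qed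

lemma ft_gauss:
  fixes \<xi> :: "'a::euclidean_space"
  assumes "e > 0"
  shows "ft (\<lambda>x. of_real (gauss e x)) \<xi> = of_real (exp (- e * (norm \<xi>)\<^sup>2 / 2))"
proof -
  have e: "1 / e > 0" using assms by simp
  have "2 * pi * e * (2 * pi * (1 / e)) = (2 * pi)\<^sup>2"
    using assms by (simp add: power2_eq_square)
  then have "sqrt (2 * pi * e) * sqrt (2 * pi * (1 / e)) = 2 * pi"
    by (simp only: real_sqrt_mult[symmetric] real_sqrt_abs) simp
  then have p: "sqrt (2 * pi * e) ^ DIM('a) * sqrt (2 * pi * (1 / e)) ^ DIM('a) = (2 * pi) ^ DIM('a)"
    by (metis power_mult_distrib)
  have "of_real (gauss e x) = complex_of_real (exp (- (1 / e) * (norm x)\<^sup>2 / 2)) / of_real (sqrt (2 * pi * e) ^ DIM('a))" for x :: 'a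
    unfolding gauss_def by (simp add: mult.commute)
  then have "ft (\<lambda>x. of_real (gauss e x)) \<xi> = ft (\<lambda>x. of_real (exp (- (1 / e) * (norm x)\<^sup>2 / 2))) \<xi> / of_real (sqrt (2 * pi * e) ^ DIM('a))"
    unfolding ft_def by simp
  also have "\<dots> = of_real ((2 * pi) ^ DIM('a) * gauss (1 / e) \<xi> / sqrt (2 * pi * e) ^ DIM('a))"
    unfolding ft_exp_gaussian(2)[OF e] by simp
  also have "(2 * pi) ^ DIM('a) * gauss (1 / e) \<xi> / sqrt (2 * pi * e) ^ DIM('a) = exp (- (norm \<xi>)\<^sup>2 / (2 * (1 / e)))"
    unfolding p[symmetric] gauss_def using assms by simp
  finally show ?thesis by (simp add: mult.commute)
qed

lemma gconv_fourier:
  fixes T w :: "'a::euclidean_space \<Rightarrow> complex"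
  assumes [measurable]: "T \<in> borel_measurable borel" "w \<in> borel_measurable borel"
    and rep: "is_fourier_of T w" and e: "e > 0"
  shows "gconv e w a = of_real ((2 * pi) powr (- real DIM('a) / 2)) *
      ft (\<lambda>x. T x * of_real (exp (- e * (norm x)\<^sup>2 / 2))) a"
proof -
  let ?\<phi> = "\<lambda>x. complex_of_real (gauss e (x - a))"
  have "schwartz ?\<phi>"
    using schwartz_chirped_gaussian[OF e, of 1 "1 / sqrt (2 * pi * e) ^ DIM('a)" a 0] by (simp add: gauss_def)
  with rep have "(LINT x|lebesgue. w x * ?\<phi> x) = (LINT x|lebesgue. T x * fourier ?\<phi> x)"
    unfolding is_fourier_of_def by blast
  moreover have "fourier ?\<phi> x = of_real ((2 * pi) powr (- real DIM('a) / 2)) * (cis (- (x \<bullet> a)) * of_real (exp (- e * (norm x)\<^sup>2 / 2)))" for x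
    using ft_shift[of "\<lambda>x. complex_of_real (gauss e x)" a x] by (simp add: fourier_eq_ft ft_gauss[OF e])
  ultimately have "(LINT x|lborel. w x * ?\<phi> x) = (LINT x|lborel. T x * (of_real ((2 * pi) powr (- real DIM('a) / 2)) * (cis (- (x \<bullet> a)) * of_real (exp (- e * (norm x)\<^sup>2 / 2)))))"
    by (simp add: integral_completion)
  also have "\<dots> = (LINT x|lborel. of_real ((2 * pi) powr (- real DIM('a) / 2)) * (cis (- (a \<bullet> x)) * (T x * of_real (exp (- e * (norm x)\<^sup>2 / 2)))))"
    by (intro Bochner_Integration.integral_cong refl) (simp add: mult_ac inner_commute)
  finally show ?thesis unfolding ft_def integral_mult_right_zero gconv_def
    by (simp add: scaleR_conv_of_real mult.commute)
qed

lemma norm_add_sq: "(norm (x + y))\<^sup>2 = (norm x)\<^sup>2 + 2 * (x \<bullet> y) + (norm (y::'a::real_inner))\<^sup>2"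
  by (simp only: power2_norm_eq_inner) (simp add: inner_add_left inner_add_right inner_commute)

text \<open>
  The phase of the test function cancels all cross terms, so every integral below is a Gaussian with a
  real frequency; only the modulus of the constant is needed, hence no branch of the square root has
  to be tracked.
\<close>

lemma fresnel_chirped_gaussian:
  fixes fr e :: real
  assumes fr: "fr > 0" and e: "e > 0"
  obtains C where "(cmod C)\<^sup>2 = 1 / (2 * pi * fr) ^ DIM('a)"
    "\<And>(a::'a::euclidean_space) x. fresnel fr (\<lambda>\<eta>. of_real (gauss e (fr *\<^sub>R \<eta> - a)) * cis (- fr / 2 * (norm \<eta>)\<^sup>2)) x
      = C * (cis (- (a \<bullet> x)) * (cis (fr / 2 * (norm x)\<^sup>2) * of_real (exp (- e * (norm x)\<^sup>2 / 2))))"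
proof -
  define W where "W = of_real (fr\<^sup>2 / e) + \<i> * of_real fr"
  define Y where "Y = 1 / W + \<i> / of_real fr"
  define \<kappa> where "\<kappa> = complex_of_real (1 / sqrt (2 * pi * e) ^ DIM('a))"
  define N where "N = complex_of_real ((2 * pi) powr (- real DIM('a) / 2))"
  have W: "Re W > 0" using assms by (simp add: W_def)
  then have W0: "W \<noteq> 0" by auto
  have Y: "Re Y > 0" using Re_divide_of_real_pos[OF W, of 1] by (simp add: Y_def)
  then have Y0: "Y \<noteq> 0" by auto
  have WY: "of_real e * (W * Y) = \<i> * of_real fr"
  proof -
    have "W * Y = 1 + \<i> * W / of_real fr" using W0 by (simp add: Y_def distrib_left)
    also have "\<dots> = \<i> * of_real fr / of_real e"
      using assms by (simp add: W_def field_simps power2_eq_square)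
    finally show ?thesis using e by simp
  qed
  have Yinv: "1 / Y = of_real e - \<i> * of_real fr"
  proof -
    have "(of_real e * W) * ((of_real e - \<i> * of_real fr) * Y) = (of_real e - \<i> * of_real fr) * (of_real e * (W * Y))"
      by (simp only: mult_ac)
    also have "\<dots> = (of_real e * W) * 1"
      unfolding WY using e by (simp add: W_def algebra_simps power2_eq_square)
    finally have "(of_real e * W) * ((of_real e - \<i> * of_real fr) * Y) = (of_real e * W) * 1" .
    moreover have "of_real e * W \<noteq> 0" using e W0 by simp
    ultimately have "(of_real e - \<i> * of_real fr) * Y = 1" by (metis mult_left_cancel)
    then show ?thesis using Y0 by (simp add: divide_eq_eq)
  qed
  define C where "C = N * N * \<kappa> * csqrt (of_real (2 * pi) / W) ^ DIM('a) * csqrt (of_real (2 * pi) / Y) ^ DIM('a)"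
  have "(cmod C)\<^sup>2 = ((cmod N)\<^sup>2)\<^sup>2 * (cmod \<kappa>)\<^sup>2 * ((cmod (csqrt (of_real (2 * pi) / W)))\<^sup>2 * (cmod (csqrt (of_real (2 * pi) / Y)))\<^sup>2) ^ DIM('a)"
    unfolding C_def norm_mult norm_power by (simp only: power_mult_distrib power2_eq_square mult_ac)
  also have "(cmod (csqrt (of_real (2 * pi) / W)))\<^sup>2 * (cmod (csqrt (of_real (2 * pi) / Y)))\<^sup>2 = (2 * pi)\<^sup>2 * e / fr"
  proof -
    have "cmod (of_real e * (W * Y)) = fr" unfolding WY using fr by (simp add: norm_mult)
    then have n: "cmod W * cmod Y = fr / e" using e by (simp add: norm_mult field_simps)
    have "(cmod (csqrt z))\<^sup>2 = cmod z" for z by (metis norm_power power2_csqrt)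
    then have "(cmod (csqrt (of_real (2 * pi) / W)))\<^sup>2 * (cmod (csqrt (of_real (2 * pi) / Y)))\<^sup>2 = (2 * pi)\<^sup>2 / (cmod W * cmod Y)"
      by (simp add: norm_divide power2_eq_square norm_mult)
    then show ?thesis unfolding n by simp
  qed
  also have "(cmod N)\<^sup>2 = 1 / (2 * pi) ^ DIM('a)" unfolding N_def using two_pi_powr_half_sq[of "DIM('a)"] by simp
  also have "(cmod \<kappa>)\<^sup>2 = 1 / (2 * pi * e) ^ DIM('a)"
    using e unfolding \<kappa>_def by (simp add: power_divide norm_divide norm_power flip: power_mult power2_eq_square)
      (simp add: power_even_abs power_mult[of _ 2] mult.commute[of _ 2] flip: power_mult_distrib)
  also have "(1 / (2 * pi) ^ DIM('a))\<^sup>2 * (1 / (2 * pi * e) ^ DIM('a)) * ((2 * pi)\<^sup>2 * e / fr) ^ DIM('a) = 1 / (2 * pi * fr) ^ DIM('a)"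
  proof -
    have "(1 / t ^ n)\<^sup>2 * (1 / (t * e) ^ n) * (t\<^sup>2 * e / fr) ^ n = (1 / t\<^sup>2 * (1 / (t * e)) * (t\<^sup>2 * e / fr)) ^ n" for t :: real and n
      by (simp only: power_mult_distrib power_divide power2_eq_square power_one times_divide_times_eq mult_1_left)
    then have "(1 / (2 * pi) ^ DIM('a))\<^sup>2 * (1 / (2 * pi * e) ^ DIM('a)) * ((2 * pi)\<^sup>2 * e / fr) ^ DIM('a)
      = (1 / (2 * pi)\<^sup>2 * (1 / (2 * pi * e)) * ((2 * pi)\<^sup>2 * e / fr)) ^ DIM('a)" .
    also have "1 / (2 * pi)\<^sup>2 * (1 / (2 * pi * e)) * ((2 * pi)\<^sup>2 * e / fr) = 1 / (2 * pi * fr)"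
      using fr e by simp
    finally show ?thesis by (simp add: power_divide)
  qed
  finally have C: "(cmod C)\<^sup>2 = 1 / (2 * pi * fr) ^ DIM('a)" .
  have gm: "(\<lambda>x::'a. exp (- z * of_real ((norm x)\<^sup>2) / 2)) \<in> borel_measurable borel" for z :: complex
    by measurable
  have "fresnel fr (\<lambda>\<eta>. of_real (gauss e (fr *\<^sub>R \<eta> - a)) * cis (- fr / 2 * (norm \<eta>)\<^sup>2)) x
      = C * (cis (- (a \<bullet> x)) * (cis (fr / 2 * (norm x)\<^sup>2) * of_real (exp (- e * (norm x)\<^sup>2 / 2))))" for a x :: 'a
  proof -
    let ?\<phi> = "\<lambda>\<eta>. of_real (gauss e (fr *\<^sub>R \<eta> - a)) * cis (- fr / 2 * (norm \<eta>)\<^sup>2)"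
    have ft\<phi>: "ft ?\<phi> \<xi> = \<kappa> * cis (- (\<xi> \<bullet> a) / fr - (norm a)\<^sup>2 / (2 * fr)) *
        (csqrt (of_real (2 * pi) / W) ^ DIM('a) * exp (- of_real ((norm (\<xi> + a))\<^sup>2) / (2 * W)))" for \<xi>
    proof -
      let ?b = "inverse fr *\<^sub>R a"
      have "ft ?\<phi> \<xi> = (LINT s|lborel. cis (- (\<xi> \<bullet> (?b + 1 *\<^sub>R s))) * ?\<phi> (?b + 1 *\<^sub>R s))"
        unfolding ft_def by (subst integral_lborel_affine(1)[where c=1 and t="?b"]) auto
      also have "\<dots> = (LINT s|lborel. (\<kappa> * cis (- (\<xi> \<bullet> a) / fr - (norm a)\<^sup>2 / (2 * fr))) *
          (exp (- W * of_real ((norm s)\<^sup>2) / 2) * cis (- ((\<xi> + a) \<bullet> s))))"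
      proof (intro Bochner_Integration.integral_cong refl)
        fix s
        have g: "fr *\<^sub>R (?b + 1 *\<^sub>R s) - a = fr *\<^sub>R s" using fr by (simp add: scaleR_add_right)
        have 1: "exp (- W * of_real ((norm s)\<^sup>2) / 2) = of_real (exp (- (norm (fr *\<^sub>R s))\<^sup>2 / (2 * e))) * cis (- fr / 2 * (norm s)\<^sup>2)"
          unfolding cis_conv_exp exp_of_real[symmetric] exp_add[symmetric]
          by (rule arg_cong[where f=exp]) (use e in \<open>simp add: W_def field_simps power_mult_distrib\<close>)
        have 2: "(norm (?b + 1 *\<^sub>R s))\<^sup>2 = (norm a)\<^sup>2 / fr\<^sup>2 + 2 * (a \<bullet> s) / fr + (norm s)\<^sup>2"
          unfolding norm_add_sq by (simp add: power_mult_distrib divide_inverse power_inverse mult_ac)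
        have 3: "- (\<xi> \<bullet> (?b + 1 *\<^sub>R s)) + (- fr / 2 * (norm (?b + 1 *\<^sub>R s))\<^sup>2)
          = (- (\<xi> \<bullet> a) / fr - (norm a)\<^sup>2 / (2 * fr)) + - ((\<xi> + a) \<bullet> s) + - fr / 2 * (norm s)\<^sup>2"
          unfolding 2 using fr by (simp add: inner_add_right inner_add_left field_simps power2_eq_square)
        have "cis (- (\<xi> \<bullet> (?b + 1 *\<^sub>R s))) * ?\<phi> (?b + 1 *\<^sub>R s)
           = of_real (gauss e (fr *\<^sub>R s)) * (cis (- (\<xi> \<bullet> (?b + 1 *\<^sub>R s)) + (- fr / 2 * (norm (?b + 1 *\<^sub>R s))\<^sup>2)))"
          unfolding g by (simp only: cis_mult[symmetric] mult_ac)
        also have "\<dots> = (\<kappa> * of_real (exp (- (norm (fr *\<^sub>R s))\<^sup>2 / (2 * e)))) *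
           (cis (- (\<xi> \<bullet> a) / fr - (norm a)\<^sup>2 / (2 * fr)) * cis (- ((\<xi> + a) \<bullet> s)) * cis (- fr / 2 * (norm s)\<^sup>2))"
          unfolding 3 cis_mult gauss_def \<kappa>_def by simp
        finally show "cis (- (\<xi> \<bullet> (?b + 1 *\<^sub>R s))) * ?\<phi> (?b + 1 *\<^sub>R s) = (\<kappa> * cis (- (\<xi> \<bullet> a) / fr - (norm a)\<^sup>2 / (2 * fr))) *
          (exp (- W * of_real ((norm s)\<^sup>2) / 2) * cis (- ((\<xi> + a) \<bullet> s)))"
          unfolding 1 by (simp only: mult_ac)
      qed
      finally show ?thesis unfolding integral_mult_right_zero gaussian_ft(2)[OF W] .
    qed
    have m: "fresnel_mult fr \<xi> * fourier ?\<phi> \<xi> = (N * \<kappa> * csqrt (of_real (2 * pi) / W) ^ DIM('a)) *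
        exp (- Y * of_real ((norm (\<xi> - (- a)))\<^sup>2) / 2)" for \<xi>
    proof -
      have 4: "fresnel_mult fr \<xi> * cis (- (\<xi> \<bullet> a) / fr - (norm a)\<^sup>2 / (2 * fr)) * exp (- of_real ((norm (\<xi> + a))\<^sup>2) / (2 * W))
         = exp (- Y * of_real ((norm (\<xi> + a))\<^sup>2) / 2)"
      proof -
        have 5: "- \<i> * of_real ((norm \<xi>)\<^sup>2 / (2 * fr)) + \<i> * of_real (- (\<xi> \<bullet> a) / fr - (norm a)\<^sup>2 / (2 * fr))
          = - (\<i> / of_real fr) * of_real ((norm (\<xi> + a))\<^sup>2) / 2"
          unfolding norm_add_sq using fr by (simp add: field_simps)
        show ?thesis
          unfolding fresnel_mult_def cis_conv_exp exp_add[symmetric] 5 unfolding Y_def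
          by (rule arg_cong[where f=exp]) (simp add: left_diff_distrib diff_divide_distrib mult.commute)
      qed
      have fe: "fourier ?\<phi> \<xi> = N * ft ?\<phi> \<xi>"
        unfolding N_def by (rule fourier_eq_ft(1)) measurable
      have "fresnel_mult fr \<xi> * fourier ?\<phi> \<xi> = (N * \<kappa> * csqrt (of_real (2 * pi) / W) ^ DIM('a)) *
        (fresnel_mult fr \<xi> * cis (- (\<xi> \<bullet> a) / fr - (norm a)\<^sup>2 / (2 * fr)) * exp (- of_real ((norm (\<xi> + a))\<^sup>2) / (2 * W)))"
        unfolding fe ft\<phi> by (simp only: mult_ac)
      then show ?thesis unfolding 4 by simp
    qed
    have "fresnel fr ?\<phi> x = N * ft (\<lambda>\<xi>. (N * \<kappa> * csqrt (of_real (2 * pi) / W) ^ DIM('a)) * exp (- Y * of_real ((norm (\<xi> - (- a)))\<^sup>2) / 2)) (- x)"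
      unfolding fresnel_def m by (subst fourier_eq_ft(2)) (auto simp: N_def)
    also have "\<dots> = N * (N * \<kappa> * csqrt (of_real (2 * pi) / W) ^ DIM('a)) * ft (\<lambda>\<xi>. exp (- Y * of_real ((norm (\<xi> - (- a)))\<^sup>2) / 2)) (- x)"
      unfolding ft_def mult.left_commute[of "cis _"] integral_mult_right_zero by (simp only: mult.assoc)
    also have "ft (\<lambda>\<xi>. exp (- Y * of_real ((norm (\<xi> - (- a)))\<^sup>2) / 2)) (- x)
      = cis (- (a \<bullet> x)) * ft (\<lambda>\<xi>. exp (- Y * of_real ((norm \<xi>)\<^sup>2) / 2)) (- x)"
      by (subst ft_shift[OF gm]) (simp add: inner_commute)
    also have "ft (\<lambda>\<xi>. exp (- Y * of_real ((norm \<xi>)\<^sup>2) / 2)) (- x)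
      = csqrt (of_real (2 * pi) / Y) ^ DIM('a) * exp (- of_real ((norm x)\<^sup>2) / (2 * Y))"
      unfolding ft_def using gaussian_ft(2)[OF Y, of "- x"] by (simp add: mult.commute)
    also have "exp (- of_real ((norm x)\<^sup>2) / (2 * Y)) = cis (fr / 2 * (norm x)\<^sup>2) * of_real (exp (- e * (norm x)\<^sup>2 / 2))"
    proof -
      have "- of_real ((norm x)\<^sup>2) / (2 * Y) = - (1 / Y) * of_real ((norm x)\<^sup>2) / 2" by simp
      also have "\<dots> = \<i> * of_real (fr / 2 * (norm x)\<^sup>2) + of_real (- e * (norm x)\<^sup>2 / 2)"
        unfolding Yinv by (simp add: algebra_simps diff_divide_distrib)
      finally show ?thesis unfolding cis_conv_exp exp_of_real[symmetric] exp_add[symmetric] by simp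
    qed
    finally show ?thesis unfolding C_def by (simp only: mult_ac)
  qed
  with C show ?thesis by (rule that)
qed

lemma gconv_fresnel:
  fixes fr e :: real
  assumes fr: "fr > 0" and e: "e > 0"
  obtains C where "(cmod C)\<^sup>2 = 1 / (2 * pi * fr) ^ DIM('a)"
    "\<And>T w (a::'a::euclidean_space). T \<in> borel_measurable borel \<Longrightarrow> w \<in> borel_measurable borel \<Longrightarrow> is_fresnel_of fr T w \<Longrightarrow>
      gconv e (\<lambda>\<xi>. w (\<xi> /\<^sub>R fr) * cis (- (norm \<xi>)\<^sup>2 / (2 * fr))) a
      = of_real (fr ^ DIM('a)) * (C * ft (\<lambda>x. T x * cis (fr / 2 * (norm x)\<^sup>2) * of_real (exp (- e * (norm x)\<^sup>2 / 2))) a)"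
proof -
  obtain C where C: "(cmod C)\<^sup>2 = 1 / (2 * pi * fr) ^ DIM('a)"
    "\<And>(a::'a) x. fresnel fr (\<lambda>\<eta>. of_real (gauss e (fr *\<^sub>R \<eta> - a)) * cis (- fr / 2 * (norm \<eta>)\<^sup>2)) x
      = C * (cis (- (a \<bullet> x)) * (cis (fr / 2 * (norm x)\<^sup>2) * of_real (exp (- e * (norm x)\<^sup>2 / 2))))"
    using fresnel_chirped_gaussian[OF fr e] by blast
  have "gconv e (\<lambda>\<xi>. w (\<xi> /\<^sub>R fr) * cis (- (norm \<xi>)\<^sup>2 / (2 * fr))) a
      = of_real (fr ^ DIM('a)) * (C * ft (\<lambda>x. T x * cis (fr / 2 * (norm x)\<^sup>2) * of_real (exp (- e * (norm x)\<^sup>2 / 2))) a)"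
    if [measurable]: "T \<in> borel_measurable borel" "w \<in> borel_measurable borel" and rep: "is_fresnel_of fr T w" for T w and a :: 'a
  proof -
    let ?\<phi> = "\<lambda>\<eta>. of_real (gauss e (fr *\<^sub>R \<eta> - a)) * cis (- fr / 2 * (norm \<eta>)\<^sup>2)"
    have "schwartz ?\<phi>"
      using schwartz_chirped_gaussian[OF e, of fr "1 / sqrt (2 * pi * e) ^ DIM('a)" a "- fr / 2"] fr by (simp add: gauss_def)
    with rep have "(LINT x|lebesgue. w x * ?\<phi> x) = (LINT x|lebesgue. T x * fresnel fr ?\<phi> x)"
      unfolding is_fresnel_of_def by blast
    then have "(LINT x|lborel. w x * ?\<phi> x) = (LINT x|lborel. T x * (C * (cis (- (a \<bullet> x)) * (cis (fr / 2 * (norm x)\<^sup>2) * of_real (exp (- e * (norm x)\<^sup>2 / 2))))))"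
      unfolding C(2) by (simp add: integral_completion)
    also have "\<dots> = (LINT x|lborel. C * (cis (- (a \<bullet> x)) * (T x * cis (fr / 2 * (norm x)\<^sup>2) * of_real (exp (- e * (norm x)\<^sup>2 / 2)))))"
      by (intro Bochner_Integration.integral_cong refl) (simp only: mult_ac)
    finally have *: "(LINT x|lborel. w x * ?\<phi> x) = C * ft (\<lambda>x. T x * cis (fr / 2 * (norm x)\<^sup>2) * of_real (exp (- e * (norm x)\<^sup>2 / 2))) a"
      unfolding ft_def integral_mult_right_zero .
    have "gconv e (\<lambda>\<xi>. w (\<xi> /\<^sub>R fr) * cis (- (norm \<xi>)\<^sup>2 / (2 * fr))) a
       = \<bar>fr\<bar> ^ DIM('a) *\<^sub>R (LINT x|lborel. gauss e (0 + fr *\<^sub>R x - a) *\<^sub>R (w ((0 + fr *\<^sub>R x) /\<^sub>R fr) * cis (- (norm (0 + fr *\<^sub>R x))\<^sup>2 / (2 * fr))))"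
      unfolding gconv_def using fr by (subst integral_lborel_affine(1)[where c=fr and t=0]) auto
    also have "(LINT x|lborel. gauss e (0 + fr *\<^sub>R x - a) *\<^sub>R (w ((0 + fr *\<^sub>R x) /\<^sub>R fr) * cis (- (norm (0 + fr *\<^sub>R x))\<^sup>2 / (2 * fr)))) = (LINT x|lborel. w x * ?\<phi> x)"
    proof (intro Bochner_Integration.integral_cong refl)
      fix x :: 'a
      have phase: "- (norm (0 + fr *\<^sub>R x))\<^sup>2 / (2 * fr) = - fr / 2 * (norm x)\<^sup>2"
        using fr by (simp add: power_mult_distrib power2_eq_square)
      show "gauss e (0 + fr *\<^sub>R x - a) *\<^sub>R (w ((0 + fr *\<^sub>R x) /\<^sub>R fr) * cis (- (norm (0 + fr *\<^sub>R x))\<^sup>2 / (2 * fr))) = w x * ?\<phi> x"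
        unfolding phase using fr by (simp add: scaleR_conv_of_real mult_ac)
    qed
    finally show ?thesis unfolding * using fr by (simp add: scaleR_conv_of_real)
  qed
  with C(1) show ?thesis by (rule that)
qed

section \<open>Limits of mollified square-integrable functions\<close>

lemma fatou_real:
  fixes f :: "'a \<Rightarrow> real"
  assumes s: "\<And>n. integrable M (s n)" "\<And>n x. s n x \<ge> 0"
    and lim: "\<And>x. (\<lambda>n. s n x) \<longlonglongrightarrow> f x"
    and r: "\<And>n. (LINT x|M. s n x) \<le> r n" "r \<longlonglongrightarrow> R"
  shows "integrable M f" "(LINT x|M. f x) \<le> R"
proof -
  have [measurable]: "s n \<in> borel_measurable M" for n using s by auto
  have [measurable]: "f \<in> borel_measurable M"
    by (rule borel_measurable_LIMSEQ_real[of M s]) (use lim in auto)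
  have f0: "f x \<ge> 0" for x by (rule LIMSEQ_le_const[OF lim]) (use s in auto)
  have "(\<integral>\<^sup>+x. ennreal (f x) \<partial>M) = (\<integral>\<^sup>+x. liminf (\<lambda>n. ennreal (s n x)) \<partial>M)"
    by (intro nn_integral_cong lim_imp_Liminf[symmetric] tendsto_ennrealI lim) auto
  also have "\<dots> \<le> liminf (\<lambda>n. \<integral>\<^sup>+x. ennreal (s n x) \<partial>M)"
    by (rule nn_integral_liminf) auto
  also have "\<dots> \<le> liminf (\<lambda>n. ennreal (r n))"
    using s r by (intro Liminf_mono always_eventually allI) (auto simp: nn_integral_eq_integral intro!: ennreal_leI)
  also have "\<dots> = ennreal R" by (intro lim_imp_Liminf tendsto_ennrealI r) auto
  finally have *: "(\<integral>\<^sup>+x. ennreal (f x) \<partial>M) \<le> ennreal R" .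
  show fi: "integrable M f"
    using * f0 by (intro integrableI_nonneg) (auto intro: le_less_trans)
  have "r n \<ge> 0" for n using r(1)[of n] s(2) by (meson Bochner_Integration.integral_nonneg order_trans)
  then have "R \<ge> 0" by (intro LIMSEQ_le_const[OF r(2)]) auto
  with * f0 show "(LINT x|M. f x) \<le> R"
    by (simp add: nn_integral_eq_integral[OF fi])
qed

lemma tendsto_integral_mult_L2:
  fixes U \<phi> :: "'a::euclidean_space \<Rightarrow> complex"
  assumes [measurable]: "U \<in> borel_measurable M" and U2: "integrable M (\<lambda>x. (cmod (U x))\<^sup>2)"
    and \<phi>: "integrable M \<phi>" and f: "\<And>n. integrable M (f n)"
    and bnd: "\<And>x. cmod (\<phi> x) \<le> B" "\<And>n x. cmod (f n x) \<le> B"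
    and L1: "(\<lambda>n. LINT x|M. cmod (f n x - \<phi> x)) \<longlonglongrightarrow> 0"
  shows "\<And>\<psi>. integrable M \<psi> \<Longrightarrow> (\<And>x. cmod (\<psi> x) \<le> B) \<Longrightarrow> integrable M (\<lambda>x. U x * \<psi> x)"
    and "(\<lambda>n. LINT x|M. U x * f n x) \<longlonglongrightarrow> (LINT x|M. U x * \<phi> x)"
proof -
  have amgm: "a * b \<le> s * a\<^sup>2 + b\<^sup>2 / s" if "s > 0" "a \<ge> 0" "b \<ge> 0" for a b s :: real
  proof -
    have "0 \<le> (s * a - b)\<^sup>2 / s + a * b" using that by simp
    also have "\<dots> = s * a\<^sup>2 + b\<^sup>2 / s - a * b"
      using that by (simp add: power2_eq_square field_simps)
    finally show ?thesis by simp
  qed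
  have sqb: "b\<^sup>2 \<le> K * b" if "0 \<le> b" "b \<le> K" for b K :: real
    using mult_right_mono[OF that(2,1)] by (simp add: power2_eq_square)
  show I: "integrable M (\<lambda>x. U x * \<psi> x)" if \<psi>: "integrable M \<psi>" "\<And>x. cmod (\<psi> x) \<le> B" for \<psi>
  proof (rule Bochner_Integration.integrable_bound[of _ "\<lambda>x. (cmod (U x))\<^sup>2 + B * cmod (\<psi> x)"])
    have [measurable]: "\<psi> \<in> borel_measurable M" using \<psi> by auto
    show "integrable M (\<lambda>x. (cmod (U x))\<^sup>2 + B * cmod (\<psi> x))" using U2 \<psi> by auto
    show "(\<lambda>x. U x * \<psi> x) \<in> borel_measurable M" by measurable
    have "cmod (U x * \<psi> x) \<le> (cmod (U x))\<^sup>2 + B * cmod (\<psi> x)" for x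
      using amgm[of 1 "cmod (U x)" "cmod (\<psi> x)"] sqb[of "cmod (\<psi> x)" B] \<psi>(2)[of x] by (simp add: norm_mult)
    then show "AE x in M. norm (U x * \<psi> x) \<le> norm ((cmod (U x))\<^sup>2 + B * cmod (\<psi> x))"
      by (intro AE_I2) (auto intro: order_trans[OF _ abs_ge_self])
  qed
  define \<omega> where "\<omega> = (\<lambda>n. LINT x|M. cmod (f n x - \<phi> x))"
  define s where "s = (\<lambda>n. sqrt (\<omega> n + inverse (real (Suc n))))"
  have \<omega>0: "\<omega> n \<ge> 0" for n by (simp add: \<omega>_def)
  have s0: "s n > 0" for n using \<omega>0[of n] by (auto simp: s_def intro!: add_nonneg_pos)
  have ss: "\<omega> n / s n \<le> s n" for n
  proof -
    have "\<omega> n \<le> s n * s n" using \<omega>0[of n] by (simp add: s_def)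
    then show ?thesis using s0[of n] by (simp add: divide_le_eq)
  qed
  have B0: "B \<ge> 0" using order_trans[OF norm_ge_zero bnd(1)] .
  have bd: "norm ((LINT x|M. U x * f n x) - (LINT x|M. U x * \<phi> x)) \<le> s n * ((LINT x|M. (cmod (U x))\<^sup>2) + 2 * B)" for n
  proof -
    let ?D = "\<lambda>x. f n x - \<phi> x"
    have D: "integrable M ?D" using f \<phi> by auto
    have DB: "cmod (?D x) \<le> 2 * B" for x
      using norm_triangle_ineq4[of "f n x" "\<phi> x"] bnd(1)[of x] bnd(2)[of n x] by linarith
    have "(LINT x|M. U x * f n x) - (LINT x|M. U x * \<phi> x) = (LINT x|M. U x * ?D x)"
      unfolding right_diff_distrib by (rule Bochner_Integration.integral_diff[symmetric]) (intro I f \<phi> bnd)+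
    also have "norm \<dots> \<le> (LINT x|M. s n * (cmod (U x))\<^sup>2 + (2 * B / s n) * cmod (?D x))"
    proof (rule Bochner_Integration.integral_norm_bound_integral)
      show "integrable M (\<lambda>x. U x * ?D x)"
        unfolding right_diff_distrib by (intro Bochner_Integration.integrable_diff I f \<phi> bnd)
      show "integrable M (\<lambda>x. s n * (cmod (U x))\<^sup>2 + (2 * B / s n) * cmod (?D x))"
        by (intro Bochner_Integration.integrable_add integrable_mult_right U2 integrable_norm D)
      fix x
      have "cmod (U x * ?D x) \<le> s n * (cmod (U x))\<^sup>2 + (cmod (?D x))\<^sup>2 / s n"
        using amgm[OF s0, of "cmod (U x)" "cmod (?D x)" n] by (simp add: norm_mult)
      also have "\<dots> \<le> s n * (cmod (U x))\<^sup>2 + (2 * B * cmod (?D x)) / s n"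
        using sqb[OF norm_ge_zero DB[of x]] s0[of n] by (intro add_left_mono divide_right_mono) auto
      finally show "cmod (U x * ?D x) \<le> s n * (cmod (U x))\<^sup>2 + (2 * B / s n) * cmod (?D x)" by simp
    qed
    also have "\<dots> = s n * (LINT x|M. (cmod (U x))\<^sup>2) + 2 * B * (\<omega> n / s n)"
      using U2 D by (simp add: \<omega>_def)
    also have "\<dots> \<le> s n * (LINT x|M. (cmod (U x))\<^sup>2) + 2 * B * s n"
      using B0 ss by (intro add_left_mono mult_left_mono) auto
    finally show ?thesis by (simp add: algebra_simps)
  qed
  have "s \<longlonglongrightarrow> sqrt (0 + 0)"
    unfolding s_def using L1 by (intro tendsto_intros LIMSEQ_inverse_real_of_nat) (simp add: \<omega>_def)
  then have "(\<lambda>n. s n * ((LINT x|M. (cmod (U x))\<^sup>2) + 2 * B)) \<longlonglongrightarrow> 0"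
    by (intro tendsto_mult_left_zero) simp
  then have "(\<lambda>n. (LINT x|M. U x * f n x) - (LINT x|M. U x * \<phi> x)) \<longlonglongrightarrow> 0"
    by (rule Lim_null_comparison[OF always_eventually[OF allI[OF bd]]])
  then show "(\<lambda>n. LINT x|M. U x * f n x) \<longlonglongrightarrow> (LINT x|M. U x * \<phi> x)"
    by (rule LIM_zero_cancel)
qed

lemma gconv_L2:
  fixes U :: "'a::euclidean_space \<Rightarrow> complex"
  assumes [measurable]: "U \<in> borel_measurable borel" and U2: "integrable lborel (\<lambda>x. (cmod (U x))\<^sup>2)"
    and e: "e > 0"
  shows "(cmod (gconv e U a))\<^sup>2 \<le> gconv e (\<lambda>x. (cmod (U x))\<^sup>2) a"
    "integrable lborel (gconv e (\<lambda>x. (cmod (U x))\<^sup>2))"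
    "integrable lborel (\<lambda>a. (cmod (gconv e U a))\<^sup>2)"
    "integrable lborel (\<lambda>x. gauss e (x - a) *\<^sub>R U x)"
    "gconv e (\<lambda>x. cmod (U x)) a \<le> 1 + 1 / sqrt (2 * pi * e) ^ DIM('a) * (LINT x|lborel. (cmod (U x))\<^sup>2)"
proof -
  note gi = integrable_gauss_mult[OF e U2]
  show le: "(cmod (gconv e U a))\<^sup>2 \<le> gconv e (\<lambda>x. (cmod (U x))\<^sup>2) a" for a
    by (rule gconv_norm_sq_le[OF e _ gi]) simp
  show "integrable lborel (\<lambda>x. gauss e (x - a) *\<^sub>R U x)"
    by (rule gconv_norm_sq_le(2)[OF e _ gi]) simp
  have "(\<lambda>n. inverse (real (Suc n)) * e) \<longlonglongrightarrow> 0 * e"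
    by (intro tendsto_intros LIMSEQ_inverse_real_of_nat)
  then show i: "integrable lborel (gconv e (\<lambda>x. (cmod (U x))\<^sup>2))"
    using gconv_tendsto_L1(1)[OF U2, of "\<lambda>n. inverse (real (Suc n)) * e" 0] e by simp
  show "integrable lborel (\<lambda>a. (cmod (gconv e U a))\<^sup>2)"
    by (rule Bochner_Integration.integrable_bound[OF i]) (use le in \<open>auto intro!: AE_I2 order_trans[OF _ abs_ge_self]\<close>)
  let ?c = "1 / sqrt (2 * pi * e) ^ DIM('a) * (LINT x|lborel. (cmod (U x))\<^sup>2)"
  have "(gconv e (\<lambda>x. cmod (U x)) a)\<^sup>2 \<le> gconv e (\<lambda>x. (cmod (U x))\<^sup>2) a"
    using gconv_norm_sq_le(1)[OF e, of "\<lambda>x. cmod (U x)" a] gi by simp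
  also have "\<dots> \<le> (LINT x|lborel. 1 / sqrt (2 * pi * e) ^ DIM('a) * (cmod (U x))\<^sup>2)"
    unfolding gconv_def using gi U2
    by (intro integral_mono) (auto intro!: mult_right_mono gauss_le[OF e, simplified] simp del: times_divide_eq_left)
  also have "\<dots> = ?c" by simp
  finally have sq: "(gconv e (\<lambda>x. cmod (U x)) a)\<^sup>2 \<le> ?c" .
  have "t \<le> 1 + t\<^sup>2" for t :: real
    using zero_le_power2[of "t - 1/2"] by (simp add: power2_eq_square algebra_simps)
  from this[of "gconv e (\<lambda>x. cmod (U x)) a"] sq show "gconv e (\<lambda>x. cmod (U x)) a \<le> 1 + ?c" by linarith
qed

lemma gconv_L2_lower_semicontinuous:
  fixes U :: "'a::euclidean_space \<Rightarrow> complex"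
  assumes [measurable]: "U \<in> borel_measurable borel" "D \<in> sets borel"
    and U2: "integrable lborel (\<lambda>x. (cmod (U x))\<^sup>2)"
    and e: "\<And>n. e n > 0" "e \<longlonglongrightarrow> 0"
    and r: "\<And>n. (LINT x|lborel. indicator D x * (cmod (gconv (e n) U x))\<^sup>2) \<le> r n" "r \<longlonglongrightarrow> R"
  shows "(LINT x|lborel. indicator D x * (cmod (U x))\<^sup>2) \<le> R"
proof -
  define \<phi> where "\<phi> = (\<lambda>k x. indicator (D \<inter> {x. cmod (U x) \<le> real k} \<inter> cball 0 (real k)) x *\<^sub>R cnj (U x))"
  have [measurable]: "\<phi> k \<in> borel_measurable borel" for k
    unfolding \<phi>_def by (intro borel_measurable_scaleR borel_measurable_indicator cnj_measurable sets.Int) auto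
  have \<phi>B: "cmod (\<phi> k x) \<le> real k" for k x by (auto simp: \<phi>_def indicator_def)
  have \<phi>i: "integrable lborel (\<phi> k)" for k
  proof (rule Bochner_Integration.integrable_bound[of _ "\<lambda>x. real k * indicator (cball 0 (real k)) x"])
    show "integrable lborel (\<lambda>x::'a. real k * indicator (cball 0 (real k)) x)"
      using emeasure_lborel_cball_finite[of "0::'a" "real k"]
      by (intro integrable_mult_right integrable_real_indicator) auto
    show "AE x in lborel. norm (\<phi> k x) \<le> norm (real k * indicator (cball 0 (real k)) x)"
      by (auto simp: \<phi>_def indicator_def)
  qed simp
  have U\<phi>: "U x * \<phi> k x = of_real ((cmod (\<phi> k x))\<^sup>2)" for k x
    by (auto simp: \<phi>_def indicator_def complex_norm_square simp del: of_real_power)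
  have \<phi>2: "integrable lborel (\<lambda>x. (cmod (\<phi> k x))\<^sup>2)" for k
    by (rule Bochner_Integration.integrable_bound[OF U2]) (auto simp: \<phi>_def indicator_def)
  have bound: "(LINT x|lborel. (cmod (\<phi> k x))\<^sup>2) \<le> R" for k
  proof -
    note g = gconv_tendsto_L1[OF \<phi>i[of k] e]
    have gB: "cmod (gconv (e n) (\<phi> k) x) \<le> real k" for n x
      by (rule integrable_gauss_mult_bounded(2)[OF e(1)]) (auto intro: \<phi>B)
    note L2 = tendsto_integral_mult_L2[OF _ U2 \<phi>i[of k] g(1) \<phi>B gB g(2)]
    have lim: "(\<lambda>n. LINT x|lborel. U x * gconv (e n) (\<phi> k) x) \<longlonglongrightarrow> (LINT x|lborel. U x * \<phi> k x)"
      by (rule L2(2)) simp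
    have sym: "(LINT x|lborel. U x * gconv (e n) (\<phi> k) x) = (LINT x|lborel. gconv (e n) U x * \<phi> k x)" for n
      by (rule gconv_symmetric[OF e(1) \<phi>i _ gconv_L2(4)[OF _ U2 e(1)] gconv_L2(5)[OF _ U2 e(1)]]) simp_all
    have Uphi: "(LINT x|lborel. U x * \<phi> k x) = of_real (LINT x|lborel. (cmod (\<phi> k x))\<^sup>2)"
      unfolding U\<phi> by (rule integral_complex_of_real)
    have le: "2 * Re (LINT x|lborel. U x * gconv (e n) (\<phi> k) x) \<le> r n + (LINT x|lborel. (cmod (\<phi> k x))\<^sup>2)" for n
    proof -
      have iD: "integrable lborel (\<lambda>x. indicator D x * (cmod (gconv (e n) U x))\<^sup>2)"
        using integrable_mult_indicator[of D lborel, OF _ gconv_L2(3)[OF _ U2 e(1)[of n]]] by simp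
      have pt: "cmod (gconv (e n) U x * \<phi> k x) \<le> (indicator D x * (cmod (gconv (e n) U x))\<^sup>2 + (cmod (\<phi> k x))\<^sup>2) / 2" for x
      proof (cases "x \<in> D")
        case True
        then show ?thesis
          using sum_squares_bound[of "cmod (gconv (e n) U x)" "cmod (\<phi> k x)"] by (simp add: norm_mult)
      next
        case False
        then show ?thesis by (simp add: \<phi>_def)
      qed
      have "Re (LINT x|lborel. gconv (e n) U x * \<phi> k x) \<le> cmod (LINT x|lborel. gconv (e n) U x * \<phi> k x)"
        by (rule complex_Re_le_cmod)
      also have "\<dots> \<le> (LINT x|lborel. (indicator D x * (cmod (gconv (e n) U x))\<^sup>2 + (cmod (\<phi> k x))\<^sup>2) / 2)"
      proof (rule Bochner_Integration.integral_norm_bound_integral)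
        show i: "integrable lborel (\<lambda>x. (indicator D x * (cmod (gconv (e n) U x))\<^sup>2 + (cmod (\<phi> k x))\<^sup>2) / 2)"
          using iD \<phi>2 by auto
        show "integrable lborel (\<lambda>x. gconv (e n) U x * \<phi> k x)"
          by (rule Bochner_Integration.integrable_bound[OF i]) (use pt in \<open>auto intro!: AE_I2 order_trans[OF _ abs_ge_self] simp del: norm_mult\<close>)
      qed (rule pt)
      also have "\<dots> = ((LINT x|lborel. indicator D x * (cmod (gconv (e n) U x))\<^sup>2) + (LINT x|lborel. (cmod (\<phi> k x))\<^sup>2)) / 2"
        using iD \<phi>2 by simp
      finally show ?thesis unfolding sym using r(1)[of n] by simp
    qed
    have "2 * Re (of_real (LINT x|lborel. (cmod (\<phi> k x))\<^sup>2)) \<le> R + (LINT x|lborel. (cmod (\<phi> k x))\<^sup>2)"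
    proof (rule LIMSEQ_le)
      show "(\<lambda>n. 2 * Re (LINT x|lborel. U x * gconv (e n) (\<phi> k) x)) \<longlonglongrightarrow> 2 * Re (of_real (LINT x|lborel. (cmod (\<phi> k x))\<^sup>2))"
        using lim unfolding Uphi by (intro tendsto_intros)
      show "(\<lambda>n. r n + (LINT x|lborel. (cmod (\<phi> k x))\<^sup>2)) \<longlonglongrightarrow> R + (LINT x|lborel. (cmod (\<phi> k x))\<^sup>2)"
        by (intro tendsto_intros r)
    qed (use le in auto)
    then show ?thesis by simp
  qed
  have "(\<lambda>k. LINT x|lborel. (cmod (\<phi> k x))\<^sup>2) \<longlonglongrightarrow> (LINT x|lborel. indicator D x * (cmod (U x))\<^sup>2)"
  proof (rule integral_dominated_convergence[where w="\<lambda>x. (cmod (U x))\<^sup>2"])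
    show "integrable lborel (\<lambda>x. (cmod (U x))\<^sup>2)" by (rule U2)
    show "AE x in lborel. (\<lambda>k. (cmod (\<phi> k x))\<^sup>2) \<longlonglongrightarrow> indicator D x * (cmod (U x))\<^sup>2"
    proof (rule AE_I2, rule tendsto_eventually)
      fix x
      obtain N where N: "real N \<ge> max (cmod (U x)) (norm x)" using real_arch_simple by blast
      show "\<forall>\<^sub>F k in sequentially. (cmod (\<phi> k x))\<^sup>2 = indicator D x * (cmod (U x))\<^sup>2"
        unfolding eventually_sequentially by (intro exI[of _ N]) (use N in \<open>auto simp: \<phi>_def indicator_def\<close>)
    qed
  qed (auto simp: \<phi>_def indicator_def)
  then show ?thesis by (rule LIMSEQ_le_const2) (use bound in auto)
qed

section \<open>The leakage estimate\<close>

lemma fresnel_leak_borel: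
  fixes fr B :: real and C Q :: "'a::euclidean_space set" and h u v g :: "'a \<Rightarrow> complex"
  assumes fr: "fr > 0" and [measurable]: "C \<in> sets borel" "Q \<in> sets borel"
    and [measurable]: "h \<in> borel_measurable borel" "u \<in> borel_measurable borel"
      "v \<in> borel_measurable borel" "g \<in> borel_measurable borel"
    and h2: "integrable lborel (\<lambda>x. (cmod (h x))\<^sup>2)" and u2: "integrable lborel (\<lambda>x. (cmod (u x))\<^sup>2)"
    and v2: "integrable lborel (\<lambda>x. (cmod (v x))\<^sup>2)" and gB: "\<And>x. cmod (g x) \<le> B"
    and supp: "\<And>x. x \<in> C \<Longrightarrow> AE y in lborel. h y \<noteq> 0 \<longrightarrow> x - y \<in> Q"
    and g_rep: "is_fresnel_of fr (indicator Q) g" and u_rep: "is_fresnel_of fr h u" and v_rep: "is_fourier_of h v"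
  shows "(LINT x|lborel. indicator C x * (cmod (u x))\<^sup>2) \<le> (LINT \<xi>|lborel. (cmod (g (\<xi> /\<^sub>R fr)))\<^sup>2 * (cmod (v \<xi>))\<^sup>2)"
proof -
  define chirp :: "'a \<Rightarrow> complex" where "chirp = (\<lambda>x. cis (fr / 2 * (norm x)\<^sup>2))"
  define E :: "real \<Rightarrow> 'a \<Rightarrow> real" where "E = (\<lambda>e x. exp (- e * (norm x)\<^sup>2 / 2))"
  define hd where "hd = (\<lambda>d y. h y * of_real (E d y))"
  define U where "U = (\<lambda>\<xi>. u (\<xi> /\<^sub>R fr) * cis (- (norm \<xi>)\<^sup>2 / (2 * fr)))"
  define G where "G = (\<lambda>\<xi>. g (\<xi> /\<^sub>R fr) * cis (- (norm \<xi>)\<^sup>2 / (2 * fr)))"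
  define p where "p = (\<lambda>\<xi>. (cmod (g (\<xi> /\<^sub>R fr)))\<^sup>2)"
  define N where "N = complex_of_real ((2 * pi) powr (- real DIM('a) / 2))"
  define e where "e = (\<lambda>n. inverse (real (Suc n)))"
  define \<tau> where "\<tau> = (\<lambda>d x. LINT y|lborel. indicator Q (x - y) * chirp (x - y) * hd d y)"
  have [measurable]: "chirp \<in> borel_measurable borel" "E d \<in> borel_measurable borel" "hd d \<in> borel_measurable borel"
    "U \<in> borel_measurable borel" "G \<in> borel_measurable borel" "p \<in> borel_measurable borel" for d
    unfolding chirp_def E_def hd_def U_def G_def p_def by measurable
  have e: "\<And>n. e n > 0" "e \<longlonglongrightarrow> 0" unfolding e_def by (simp, rule LIMSEQ_inverse_real_of_nat)
  have chirp1: "cmod (chirp x) = 1" for x by (simp add: chirp_def)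
  have E0: "0 \<le> E d x" for d x by (simp add: E_def)
  have E1: "E d x \<le> 1" if "d > 0" for d x using that by (simp add: E_def)
  have Ei: "integrable lborel (E d)" if "d > 0" for d unfolding E_def by (rule ft_exp_gaussian(1)[OF that])
  have Gp: "(cmod (G \<xi>))\<^sup>2 = p \<xi>" for \<xi> by (simp add: G_def p_def norm_mult)
  have p0: "p \<xi> \<ge> 0" for \<xi> by (simp add: p_def)
  have pB: "norm (p \<xi>) \<le> B\<^sup>2" for \<xi> using gB by (simp add: p_def power_mono)
  have hdi: "integrable lborel (hd d)" if d: "d > 0" for d
  proof (rule Bochner_Integration.integrable_bound[of _ "\<lambda>x. (cmod (h x))\<^sup>2 + E d x"])
    show "integrable lborel (\<lambda>x. (cmod (h x))\<^sup>2 + E d x)" using h2 Ei[OF d] by auto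
    have "cmod (hd d x) \<le> (cmod (h x))\<^sup>2 + E d x" for x
    proof -
      have "2 * cmod (h x) * E d x \<le> (cmod (h x))\<^sup>2 + (E d x)\<^sup>2" by (rule sum_squares_bound)
      moreover have "(E d x)\<^sup>2 \<le> E d x" using mult_right_mono[OF E1[OF d] E0, of x d x] by (simp add: power2_eq_square)
      moreover have "0 \<le> cmod (h x) * E d x" using E0 by simp
      moreover have "cmod (hd d x) = cmod (h x) * E d x" using E0 by (simp add: hd_def norm_mult)
      ultimately show ?thesis by linarith
    qed
    then show "AE x in lborel. norm (hd d x) \<le> norm ((cmod (h x))\<^sup>2 + E d x)"
      by (intro AE_I2) (auto intro: order_trans[OF _ abs_ge_self])
  qed simp
  have vd: "gconv d v a = N * ft (hd d) a" if "d > 0" for d a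
    unfolding N_def hd_def E_def by (rule gconv_fourier[OF _ _ v_rep that]) simp_all
  have ft_hd: "(cmod (ft (hd d) a))\<^sup>2 = (2 * pi) ^ DIM('a) * (cmod (gconv d v a))\<^sup>2" if "d > 0" for d a
    using two_pi_powr_half_sq[of "DIM('a)"] unfolding vd[OF that] N_def by (simp add: norm_mult power_mult_distrib)
  have \<tau>_bound: "integrable lborel (\<lambda>x. (cmod (\<tau> d x))\<^sup>2) \<and>
      (LINT x|lborel. (cmod (\<tau> d x))\<^sup>2) \<le> (2 * pi) ^ DIM('a) / fr ^ DIM('a) * (LINT \<xi>|lborel. p \<xi> * (cmod (gconv d v \<xi>))\<^sup>2)"
    if d: "d > 0" for d
  proof -
    define T where "T = (\<lambda>n x. indicator Q x * chirp x * of_real (E (e n) x))"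
    have [measurable]: "T n \<in> borel_measurable borel" for n unfolding T_def by measurable
    have TE: "cmod (T n x) \<le> E (e n) x" for n x using E0 by (simp add: T_def norm_mult chirp1 indicator_def)
    have Ti: "integrable lborel (T n)" for n
      by (rule Bochner_Integration.integrable_bound[OF Ei[OF e(1)[of n]]])
        (use TE in \<open>auto intro!: AE_I2 order_trans[OF _ abs_ge_self]\<close>)
    define \<psi> where "\<psi> = (\<lambda>n x. LINT y|lborel. T n (x - y) * hd d y)"
    note conv = ft_convolution[OF Ti hdi[OF d]]
    have \<psi>i: "integrable lborel (\<psi> n)" for n unfolding \<psi>_def by (rule conv)
    have Th: "cmod (T n (x - y) * hd d y) \<le> cmod (hd d y)" for n x y
      using mult_right_mono[OF order_trans[OF TE E1[OF e(1)]] norm_ge_zero] by (simp add: norm_mult)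
    have \<psi>B: "cmod (\<psi> n x) \<le> (LINT y|lborel. cmod (hd d y))" for n x
      unfolding \<psi>_def
    proof (rule Bochner_Integration.integral_norm_bound_integral)
      show "integrable lborel (\<lambda>y. T n (x - y) * hd d y)"
        by (rule Bochner_Integration.integrable_bound[OF hdi[OF d]]) (use Th in auto)
    qed (use hdi[OF d] Th in auto)
    have ftT: "(cmod (ft (T n) a))\<^sup>2 \<le> (2 * pi) ^ DIM('a) / fr ^ DIM('a) * gconv (e n) p a" for n a
    proof -
      obtain c where c: "(cmod c)\<^sup>2 = 1 / (2 * pi * fr) ^ DIM('a)"
        "\<And>S w (a::'a). S \<in> borel_measurable borel \<Longrightarrow> w \<in> borel_measurable borel \<Longrightarrow> is_fresnel_of fr S w \<Longrightarrow>
          gconv (e n) (\<lambda>\<xi>. w (\<xi> /\<^sub>R fr) * cis (- (norm \<xi>)\<^sup>2 / (2 * fr))) a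
          = of_real (fr ^ DIM('a)) * (c * ft (\<lambda>x. S x * cis (fr / 2 * (norm x)\<^sup>2) * of_real (exp (- e n * (norm x)\<^sup>2 / 2))) a)"
        using gconv_fresnel[OF fr e(1)] by blast
      have "gconv (e n) G a = of_real (fr ^ DIM('a)) * (c * ft (T n) a)"
        unfolding G_def T_def chirp_def E_def by (rule c(2)[OF _ _ g_rep]) simp_all
      then have "(cmod (gconv (e n) G a))\<^sup>2 = (fr ^ DIM('a))\<^sup>2 * (1 / (2 * pi * fr) ^ DIM('a)) * (cmod (ft (T n) a))\<^sup>2"
        using fr by (simp add: norm_mult norm_power power_mult_distrib c(1))
      also have "(fr ^ DIM('a))\<^sup>2 * (1 / (2 * pi * fr) ^ DIM('a)) = fr ^ DIM('a) / (2 * pi) ^ DIM('a)"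
        using fr by (simp add: power_mult_distrib power2_eq_square)
      finally have "(cmod (ft (T n) a))\<^sup>2 = (2 * pi) ^ DIM('a) / fr ^ DIM('a) * (cmod (gconv (e n) G a))\<^sup>2"
        using fr by simp
      moreover have "(cmod (gconv (e n) G a))\<^sup>2 \<le> gconv (e n) p a"
      proof -
        have "integrable lborel (\<lambda>x. gauss (e n) (x - a) *\<^sub>R p x)"
          by (rule integrable_gauss_mult_bounded(1)[OF e(1) _ pB]) simp
        then show ?thesis using gconv_norm_sq_le(1)[OF e(1), of G n a] by (simp add: Gp)
      qed
      ultimately show ?thesis using fr by (simp add: divide_right_mono)
    qed
    define F where "F = (\<lambda>\<xi>. (cmod (gconv d v \<xi>))\<^sup>2)"
    have Fi: "integrable lborel F" unfolding F_def by (rule gconv_L2(3)[OF _ v2 d]) simp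
    have [measurable]: "F \<in> borel_measurable borel" unfolding F_def by measurable
    have F0: "F \<xi> \<ge> 0" for \<xi> by (simp add: F_def)
    have gpB: "norm (gconv (e n) p a) \<le> B\<^sup>2" for n a
      by (rule integrable_gauss_mult_bounded(2)[OF e(1) _ pB]) simp
    have gpF: "integrable lborel (\<lambda>\<xi>. gconv (e n) p \<xi> * F \<xi>)" for n
      by (rule Bochner_Integration.integrable_bound[of _ "\<lambda>\<xi>. B\<^sup>2 * F \<xi>"])
        (use Fi gpB F0 in \<open>auto simp: abs_mult intro!: AE_I2 mult_right_mono\<close>)
    let ?c = "(2 * pi) ^ DIM('a) * ((2 * pi) ^ DIM('a) / fr ^ DIM('a))"
    have ft\<psi>: "(cmod (ft (\<psi> n) \<xi>))\<^sup>2 \<le> ?c * (gconv (e n) p \<xi> * F \<xi>)" for n \<xi>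
    proof -
      have "(cmod (ft (\<psi> n) \<xi>))\<^sup>2 = (cmod (ft (T n) \<xi>))\<^sup>2 * ((2 * pi) ^ DIM('a) * F \<xi>)"
        unfolding \<psi>_def conv(2) norm_mult power_mult_distrib ft_hd[OF d] F_def ..
      also have "\<dots> \<le> ((2 * pi) ^ DIM('a) / fr ^ DIM('a) * gconv (e n) p \<xi>) * ((2 * pi) ^ DIM('a) * F \<xi>)"
        using F0 by (intro mult_right_mono ftT) auto
      finally show ?thesis by (simp only: mult_ac)
    qed
    have ft\<psi>i: "integrable lborel (\<lambda>\<xi>. (cmod (ft (\<psi> n) \<xi>))\<^sup>2)" for n
    proof (rule Bochner_Integration.integrable_bound)
      show "integrable lborel (\<lambda>\<xi>. ?c * (gconv (e n) p \<xi> * F \<xi>))" using gpF by (rule integrable_mult_right)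
      have [measurable]: "\<psi> n \<in> borel_measurable borel" using \<psi>i[of n] by auto
      show "(\<lambda>\<xi>. (cmod (ft (\<psi> n) \<xi>))\<^sup>2) \<in> borel_measurable lborel" by measurable
      show "AE \<xi> in lborel. norm ((cmod (ft (\<psi> n) \<xi>))\<^sup>2) \<le> norm (?c * (gconv (e n) p \<xi> * F \<xi>))"
        using order_trans[OF ft\<psi> abs_ge_self] by (intro AE_I2) simp
    qed
    let ?r = "\<lambda>n. (2 * pi) ^ DIM('a) / fr ^ DIM('a) * (LINT \<xi>|lborel. p \<xi> * gconv (e n) F \<xi>)"
    have \<psi>2: "(LINT x|lborel. (cmod (\<psi> n x))\<^sup>2) \<le> ?r n" for n
    proof -
      have "(2 * pi) ^ DIM('a) * (LINT x|lborel. (cmod (\<psi> n x))\<^sup>2) \<le> (LINT \<xi>|lborel. (cmod (ft (\<psi> n) \<xi>))\<^sup>2)"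
        by (rule plancherel_le[OF \<psi>i \<psi>B ft\<psi>i])
      also have "\<dots> \<le> (LINT \<xi>|lborel. ?c * (gconv (e n) p \<xi> * F \<xi>))"
        by (rule integral_mono[OF ft\<psi>i integrable_mult_right[OF gpF] ft\<psi>])
      also have "\<dots> = ?c * (LINT \<xi>|lborel. gconv (e n) p \<xi> * F \<xi>)" by (rule integral_mult_right_zero)
      also have "(LINT \<xi>|lborel. gconv (e n) p \<xi> * F \<xi>) = (LINT \<xi>|lborel. p \<xi> * gconv (e n) F \<xi>)"
      proof (rule gconv_symmetric[OF e(1) Fi, symmetric])
        show "integrable lborel (\<lambda>a. gauss (e n) (a - x) *\<^sub>R p a)" for x
          by (rule integrable_gauss_mult_bounded(1)[OF e(1) _ pB]) simp
        show "gconv (e n) (\<lambda>a. norm (p a)) x \<le> B\<^sup>2" for x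
          using gpB[of n x] p0 by simp
      qed simp
      finally have "(2 * pi) ^ DIM('a) * (LINT x|lborel. (cmod (\<psi> n x))\<^sup>2) \<le> (2 * pi) ^ DIM('a) * ?r n"
        by (simp only: mult.assoc)
      then show ?thesis by (rule mult_left_le_imp_le) simp
    qed
    have r_lim: "?r \<longlonglongrightarrow> (2 * pi) ^ DIM('a) / fr ^ DIM('a) * (LINT \<xi>|lborel. p \<xi> * F \<xi>)"
      by (intro tendsto_mult_left tendsto_integral_mult_gconv[OF Fi e _ pB]) simp
    have \<psi>2i: "integrable lborel (\<lambda>x. (cmod (\<psi> n x))\<^sup>2)" for n
    proof (rule Bochner_Integration.integrable_bound)
      let ?M = "LINT y|lborel. cmod (hd d y)"
      have [measurable]: "\<psi> n \<in> borel_measurable borel" using \<psi>i[of n] by auto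
      show "integrable lborel (\<lambda>x. ?M * cmod (\<psi> n x))" using \<psi>i by auto
      show "(\<lambda>x. (cmod (\<psi> n x))\<^sup>2) \<in> borel_measurable lborel" by measurable
      show "AE x in lborel. norm ((cmod (\<psi> n x))\<^sup>2) \<le> norm (?M * cmod (\<psi> n x))"
        using mult_right_mono[OF \<psi>B norm_ge_zero] by (intro AE_I2) (simp add: power2_eq_square abs_mult)
    qed
    have \<psi>_lim: "(\<lambda>n. \<psi> n x) \<longlonglongrightarrow> \<tau> d x" for x
      unfolding \<psi>_def \<tau>_def
    proof (rule integral_dominated_convergence[where w="\<lambda>y. cmod (hd d y)"])
      show "integrable lborel (\<lambda>y. cmod (hd d y))" using hdi[OF d] by auto
      have "(\<lambda>n. T n z) \<longlonglongrightarrow> indicator Q z * chirp z * of_real (exp (- 0 * (norm z)\<^sup>2 / 2))" for z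
        unfolding T_def E_def by (intro tendsto_intros e) auto
      then show "AE y in lborel. (\<lambda>n. T n (x - y) * hd d y) \<longlonglongrightarrow> indicator Q (x - y) * chirp (x - y) * hd d y"
        by (intro AE_I2 tendsto_mult tendsto_const) simp
    qed (use Th in auto)
    show ?thesis
      unfolding F_def[symmetric]
      using fatou_real[OF \<psi>2i _ tendsto_power[OF tendsto_norm[OF \<psi>_lim]] \<psi>2 r_lim] by (simp add: F_def)
  qed
  have vlim: "(\<lambda>n. LINT \<xi>|lborel. p \<xi> * gconv (e n) (\<lambda>x. (cmod (v x))\<^sup>2) \<xi>) \<longlonglongrightarrow> (LINT \<xi>|lborel. p \<xi> * (cmod (v \<xi>))\<^sup>2)"
    by (rule tendsto_integral_mult_gconv[OF v2 e _ pB]) simp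
  define D where "D = (\<lambda>x. x /\<^sub>R fr) -` C"
  have Dm[measurable]: "D \<in> sets borel"
    unfolding D_def using measurable_sets[of "\<lambda>x. x /\<^sub>R fr" borel borel C] by simp
  have indD: "indicator D (0 + fr *\<^sub>R x) = (indicator C x :: real)" for x
    using fr by (simp add: D_def indicator_def)
  have U2: "integrable lborel (\<lambda>x. (cmod (U x))\<^sup>2)"
  proof -
    have "integrable lborel (\<lambda>x. (cmod (U (0 + fr *\<^sub>R x)))\<^sup>2)"
      using u2 fr by (simp add: U_def norm_mult)
    then show ?thesis using integral_lborel_affine(2)[of "\<lambda>x. (cmod (U x))\<^sup>2" fr 0] fr by simp
  qed
  have step: "(LINT \<xi>|lborel. indicator D \<xi> * (cmod (gconv d U \<xi>))\<^sup>2)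
      \<le> fr ^ DIM('a) * (LINT \<xi>|lborel. p \<xi> * gconv d (\<lambda>x. (cmod (v x))\<^sup>2) \<xi>)" if d: "d > 0" for d
  proof -
    obtain c where c: "(cmod c)\<^sup>2 = 1 / (2 * pi * fr) ^ DIM('a)"
      "\<And>S w (a::'a). S \<in> borel_measurable borel \<Longrightarrow> w \<in> borel_measurable borel \<Longrightarrow> is_fresnel_of fr S w \<Longrightarrow>
        gconv d (\<lambda>\<xi>. w (\<xi> /\<^sub>R fr) * cis (- (norm \<xi>)\<^sup>2 / (2 * fr))) a
        = of_real (fr ^ DIM('a)) * (c * ft (\<lambda>x. S x * cis (fr / 2 * (norm x)\<^sup>2) * of_real (exp (- d * (norm x)\<^sup>2 / 2))) a)"
      using gconv_fresnel[OF fr d] by blast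
    have Ueq: "gconv d U a = of_real (fr ^ DIM('a)) * (c * ft (\<lambda>x. h x * chirp x * of_real (E d x)) a)" for a
      unfolding U_def chirp_def E_def by (rule c(2)[OF _ _ u_rep]) simp_all
    have tau: "cmod (ft (\<lambda>x. h x * chirp x * of_real (E d x)) (fr *\<^sub>R x)) = cmod (\<tau> d x)" if x: "x \<in> C" for x
    proof -
      have "ft (\<lambda>x. h x * chirp x * of_real (E d x)) (fr *\<^sub>R x) = (LINT y|lborel. cis (- fr / 2 * (norm x)\<^sup>2) * (chirp (x - y) * hd d y))"
        unfolding ft_def
      proof (intro Bochner_Integration.integral_cong refl)
        fix y
        have nrm: "(norm (x - y))\<^sup>2 = (norm x)\<^sup>2 - 2 * (x \<bullet> y) + (norm y)\<^sup>2"
          using norm_add_sq[of x "- y"] by simp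
        have "- ((fr *\<^sub>R x) \<bullet> y) + fr / 2 * (norm y)\<^sup>2 = - fr / 2 * (norm x)\<^sup>2 + fr / 2 * (norm (x - y))\<^sup>2"
          unfolding nrm by (simp add: algebra_simps)
        then have *: "cis (- ((fr *\<^sub>R x) \<bullet> y)) * chirp y = cis (- fr / 2 * (norm x)\<^sup>2) * chirp (x - y)"
          unfolding chirp_def cis_mult by (rule arg_cong)
        have "cis (- ((fr *\<^sub>R x) \<bullet> y)) * (h y * chirp y * of_real (E d y)) = (cis (- ((fr *\<^sub>R x) \<bullet> y)) * chirp y) * hd d y"
          unfolding hd_def by (simp only: mult_ac)
        then show "cis (- ((fr *\<^sub>R x) \<bullet> y)) * (h y * chirp y * of_real (E d y)) = cis (- fr / 2 * (norm x)\<^sup>2) * (chirp (x - y) * hd d y)"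
          unfolding * by (simp only: mult.assoc)
      qed
      also have "\<dots> = cis (- fr / 2 * (norm x)\<^sup>2) * (LINT y|lborel. chirp (x - y) * hd d y)"
        by (rule integral_mult_right_zero)
      also have "(LINT y|lborel. chirp (x - y) * hd d y) = \<tau> d x"
        unfolding \<tau>_def
      proof (rule integral_cong_AE)
        show "AE y in lborel. chirp (x - y) * hd d y = indicator Q (x - y) * chirp (x - y) * hd d y"
          using supp[OF x] by eventually_elim (auto simp: hd_def indicator_def)
      qed auto
      finally show ?thesis by (simp add: norm_mult)
    qed
    have "(LINT \<xi>|lborel. indicator D \<xi> * (cmod (gconv d U \<xi>))\<^sup>2)
       = fr ^ DIM('a) * (LINT x|lborel. indicator D (0 + fr *\<^sub>R x) * (cmod (gconv d U (0 + fr *\<^sub>R x)))\<^sup>2)"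
      using fr by (subst integral_lborel_affine(1)[where c=fr and t=0]) auto
    also have "(LINT x|lborel. indicator D (0 + fr *\<^sub>R x) * (cmod (gconv d U (0 + fr *\<^sub>R x)))\<^sup>2)
       \<le> (LINT x|lborel. fr ^ DIM('a) / (2 * pi) ^ DIM('a) * (cmod (\<tau> d x))\<^sup>2)"
    proof (rule integral_mono)
      show "integrable lborel (\<lambda>x. fr ^ DIM('a) / (2 * pi) ^ DIM('a) * (cmod (\<tau> d x))\<^sup>2)"
        using \<tau>_bound[OF d] by (intro integrable_mult_right) auto
      have "integrable lborel (\<lambda>x. indicator D x * (cmod (gconv d U x))\<^sup>2)"
        using integrable_mult_indicator[of D lborel, OF _ gconv_L2(3)[OF _ U2 d]] by simp
      then show "integrable lborel (\<lambda>x. indicator D (0 + fr *\<^sub>R x) * (cmod (gconv d U (0 + fr *\<^sub>R x)))\<^sup>2)"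
        using integral_lborel_affine(2)[of "\<lambda>x. indicator D x * (cmod (gconv d U x))\<^sup>2" fr 0] fr by simp
      fix x :: 'a
      show "indicator D (0 + fr *\<^sub>R x) * (cmod (gconv d U (0 + fr *\<^sub>R x)))\<^sup>2 \<le> fr ^ DIM('a) / (2 * pi) ^ DIM('a) * (cmod (\<tau> d x))\<^sup>2"
      proof (cases "x \<in> C")
        case True
        have "(cmod (gconv d U (0 + fr *\<^sub>R x)))\<^sup>2 = (fr ^ DIM('a))\<^sup>2 * (1 / (2 * pi * fr) ^ DIM('a)) * (cmod (\<tau> d x))\<^sup>2"
          using fr tau[OF True] by (simp add: Ueq norm_mult norm_power power_mult_distrib c(1))
        also have "(fr ^ DIM('a))\<^sup>2 * (1 / (2 * pi * fr) ^ DIM('a)) = fr ^ DIM('a) / (2 * pi) ^ DIM('a)"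
          using fr by (simp add: power_mult_distrib power2_eq_square)
        finally show ?thesis unfolding indD using True by simp
      next
        case False
        then show ?thesis unfolding indD using fr by simp
      qed
    qed
    also have "(LINT x|lborel. fr ^ DIM('a) / (2 * pi) ^ DIM('a) * (cmod (\<tau> d x))\<^sup>2)
        = fr ^ DIM('a) / (2 * pi) ^ DIM('a) * (LINT x|lborel. (cmod (\<tau> d x))\<^sup>2)" by (rule integral_mult_right_zero)
    also have "\<dots> \<le> fr ^ DIM('a) / (2 * pi) ^ DIM('a) * ((2 * pi) ^ DIM('a) / fr ^ DIM('a) * (LINT \<xi>|lborel. p \<xi> * (cmod (gconv d v \<xi>))\<^sup>2))"
      using \<tau>_bound[OF d] fr by (intro mult_left_mono) auto
    also have "\<dots> = (LINT \<xi>|lborel. p \<xi> * (cmod (gconv d v \<xi>))\<^sup>2)" using fr by simp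
    also have "\<dots> \<le> (LINT \<xi>|lborel. p \<xi> * gconv d (\<lambda>x. (cmod (v x))\<^sup>2) \<xi>)"
    proof (rule integral_mono)
      have P: "integrable lborel (\<lambda>\<xi>. p \<xi> * f \<xi>)" if "integrable lborel f" for f :: "'a \<Rightarrow> real"
      proof (rule Bochner_Integration.integrable_bound[of _ "\<lambda>\<xi>. B\<^sup>2 * f \<xi>"])
        have [measurable]: "f \<in> borel_measurable borel" using that by auto
        show "(\<lambda>\<xi>. p \<xi> * f \<xi>) \<in> borel_measurable lborel" by simp
      qed (use that pB in \<open>auto simp: abs_mult intro!: AE_I2 mult_right_mono\<close>)
      show "integrable lborel (\<lambda>\<xi>. p \<xi> * (cmod (gconv d v \<xi>))\<^sup>2)" by (rule P, rule gconv_L2(3)[OF _ v2 d]) simp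
      show "integrable lborel (\<lambda>\<xi>. p \<xi> * gconv d (\<lambda>x. (cmod (v x))\<^sup>2) \<xi>)" by (rule P, rule gconv_L2(2)[OF _ v2 d]) simp
      show "p \<xi> * (cmod (gconv d v \<xi>))\<^sup>2 \<le> p \<xi> * gconv d (\<lambda>x. (cmod (v x))\<^sup>2) \<xi>" for \<xi>
        by (intro mult_left_mono p0 gconv_L2(1)[OF _ v2 d]) simp
    qed
    finally show ?thesis using fr by simp
  qed
  have "(LINT \<xi>|lborel. indicator D \<xi> * (cmod (U \<xi>))\<^sup>2) \<le> fr ^ DIM('a) * (LINT \<xi>|lborel. p \<xi> * (cmod (v \<xi>))\<^sup>2)"
    by (rule gconv_L2_lower_semicontinuous[OF _ Dm U2 e step[OF e(1)] tendsto_mult_left[OF vlim]]) simp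
  moreover have "(LINT \<xi>|lborel. indicator D \<xi> * (cmod (U \<xi>))\<^sup>2) = fr ^ DIM('a) * (LINT x|lborel. indicator C x * (cmod (u x))\<^sup>2)"
  proof -
    have "(LINT \<xi>|lborel. indicator D \<xi> * (cmod (U \<xi>))\<^sup>2) = fr ^ DIM('a) * (LINT x|lborel. indicator D (0 + fr *\<^sub>R x) * (cmod (U (0 + fr *\<^sub>R x)))\<^sup>2)"
      using fr by (subst integral_lborel_affine(1)[where c=fr and t=0]) auto
    then show ?thesis unfolding indD using fr by (simp add: U_def norm_mult)
  qed
  ultimately have "fr ^ DIM('a) * (LINT x|lborel. indicator C x * (cmod (u x))\<^sup>2) \<le> fr ^ DIM('a) * (LINT \<xi>|lborel. p \<xi> * (cmod (v \<xi>))\<^sup>2)"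
    by simp
  then show ?thesis using fr unfolding p_def by (simp add: mult_le_cancel_left_pos)
qed

lemma integral_lebesgue_eq_lborel:
  fixes f f' :: "'a::euclidean_space \<Rightarrow> 'b::euclidean_space"
  assumes f': "f' \<in> borel_measurable borel" and ae: "AE x in lborel. f x = f' x"
  shows "(LINT x|lebesgue. f x) = (LINT x|lborel. f' x)"
    and "integrable lebesgue f \<longleftrightarrow> integrable lborel f'"
proof -
  have m: "f' \<in> borel_measurable lebesgue" using f' by (intro measurable_completion) simp
  have ae': "AE x in lebesgue. f' x = f x" using AE_completion[OF ae] by eventually_elim simp
  have f: "f \<in> borel_measurable lebesgue" by (rule borel_measurable_AE[OF m ae'])
  have "(LINT x|lebesgue. f x) = (LINT x|lebesgue. f' x)"
    by (rule integral_cong_AE[OF f m]) (use ae' in \<open>auto elim: eventually_mono\<close>)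
  then show "(LINT x|lebesgue. f x) = (LINT x|lborel. f' x)" using f' by (simp add: integral_completion)
  have "integrable lebesgue f \<longleftrightarrow> integrable lebesgue f'"
    by (rule integrable_cong_AE[OF f m]) (use ae' in \<open>auto elim: eventually_mono\<close>)
  then show "integrable lebesgue f \<longleftrightarrow> integrable lborel f'" using f' by (simp add: integrable_completion)
qed

lemma ex_borel_representative:
  fixes f :: "'a::euclidean_space \<Rightarrow> complex"
  assumes "f \<in> borel_measurable lebesgue"
  obtains f' where "f' \<in> borel_measurable borel" "AE x in lborel. f x = f' x"
proof -
  have "(\<lambda>x. Re (f x)) \<in> borel_measurable lebesgue" "(\<lambda>x. Im (f x)) \<in> borel_measurable lebesgue"
    using assms by simp_all
  from this[THEN completion_ex_borel_measurable_real]
  obtain a b where [measurable]: "a \<in> borel_measurable lborel" "b \<in> borel_measurable lborel"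
    and "AE x in lborel. Re (f x) = a x" "AE x in lborel. Im (f x) = b x" by auto
  then have "AE x in lborel. f x = of_real (a x) + \<i> * of_real (b x)"
    by (auto elim!: eventually_elim2 simp: complex_eq_iff)
  moreover have "(\<lambda>x. of_real (a x) + \<i> * of_real (b x)) \<in> borel_measurable borel" by simp
  ultimately show ?thesis by (rule that[rotated])
qed

lemma AE_lborel_affine:
  fixes t :: "'a::euclidean_space"
  assumes "AE x in lborel. P x" and c: "c \<noteq> 0"
  shows "AE x in lborel. P (t + c *\<^sub>R x)"
proof -
  obtain N where N: "N \<in> null_sets lborel" "{x \<in> space lborel. \<not> P x} \<subseteq> N"
    using assms(1) by (auto simp: eventually_ae_filter)
  have Nm[measurable]: "N \<in> sets borel" using N by (auto dest: null_setsD2)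
  have "AE x in lborel. x \<notin> N" using N by (intro AE_not_in)
  then have "AE x in density (distr lborel borel (\<lambda>x. t + c *\<^sub>R x)) (\<lambda>_. ennreal (\<bar>c\<bar> ^ DIM('a))). x \<notin> N"
    by (subst (asm) lborel_affine[OF c, of t])
  then have "AE x in distr lborel borel (\<lambda>x. t + c *\<^sub>R x). x \<notin> N"
    using c by (subst (asm) AE_density) (auto elim!: eventually_mono)
  then have "AE x in lborel. t + c *\<^sub>R x \<notin> N"
    by (subst (asm) AE_distr_iff) auto
  then show ?thesis using N(2) by (auto elim!: eventually_mono)
qed

lemma schwartz_measurable:
  assumes "schwartz \<phi>" shows "\<phi> \<in> borel_measurable borel"
proof -
  have "\<phi> differentiable (at x)" for x
    using assms unfolding schwartz_def by (metis empty_subsetI iter_deriv.simps(1) list.set(1))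
  then have "continuous_on UNIV \<phi>"
    by (intro continuous_at_imp_continuous_on ballI differentiable_imp_continuous_within)
  then show ?thesis by (rule borel_measurable_continuous_onI)
qed

lemma fourier_measurable:
  assumes [measurable]: "\<phi> \<in> borel_measurable borel"
  shows "fourier \<phi> \<in> borel_measurable borel" "fresnel fr \<phi> \<in> borel_measurable borel"
proof -
  show [measurable]: "fourier \<phi> \<in> borel_measurable borel"
    using ft_measurable[OF assms] by (simp add: fourier_eq_ft[OF assms, abs_def])
  have m: "(\<lambda>\<xi>. fresnel_mult fr \<xi> * fourier \<phi> \<xi>) \<in> borel_measurable borel"
    unfolding fresnel_mult_def by measurable
  have [measurable]: "ft (\<lambda>\<xi>. fresnel_mult fr \<xi> * fourier \<phi> \<xi>) \<in> borel_measurable borel"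
    by (rule ft_measurable[OF m])
  show "fresnel fr \<phi> \<in> borel_measurable borel"
    unfolding fresnel_def fourier_eq_ft(2)[OF m, abs_def] by measurable
qed

lemma is_fourier_is_fresnel_AE_cong:
  fixes T T' w w' :: "'a::euclidean_space \<Rightarrow> complex"
  assumes T': "T' \<in> borel_measurable borel" "AE x in lborel. T x = T' x"
    and w': "w' \<in> borel_measurable borel" "AE x in lborel. w x = w' x"
  shows "is_fourier_of T w \<Longrightarrow> is_fourier_of T' w'"
    and "is_fresnel_of fr T w \<Longrightarrow> is_fresnel_of fr T' w'"
proof -
  have eq: "(LINT x|lebesgue. S x * f x) = (LINT x|lebesgue. S' x * f x)"
    if [measurable]: "S' \<in> borel_measurable borel" "f \<in> borel_measurable borel" and ae: "AE x in lborel. S x = S' x"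
    for S S' f :: "'a \<Rightarrow> complex"
  proof -
    have "(LINT x|lebesgue. S x * f x) = (LINT x|lborel. S' x * f x)"
      by (rule integral_lebesgue_eq_lborel(1)) (use ae in \<open>auto elim!: eventually_mono\<close>)
    then show ?thesis by (simp add: integral_completion)
  qed
  show "is_fourier_of T w \<Longrightarrow> is_fourier_of T' w'" "is_fresnel_of fr T w \<Longrightarrow> is_fresnel_of fr T' w'"
    unfolding is_fourier_of_def is_fresnel_of_def
    by (simp_all only: eq[OF T'(1) _ T'(2)] eq[OF w'(1) _ w'(2)] schwartz_measurable fourier_measurable
        simp_thms cong: imp_cong)
qed

theorem theorem4p2:
  fixes fr :: real and K \<Omega> P :: "'a::euclidean_space set" and g :: "'a \<Rightarrow> complex"
  assumes fr_pos: "fr > 0"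
    and K_meas: "K \<in> sets lebesgue" and \<Omega>_meas: "\<Omega> \<in> sets lebesgue" and P_meas: "P \<in> sets lebesgue"
    and frontier_null: "frontier K \<in> null_sets lebesgue"
    and sum_sub: "{x + y | x y. x \<in> \<Omega> \<and> y \<in> P} \<subseteq> K"
    and g_Linf: "Linf g"
    and g_rep: "is_fresnel_of fr (\<lambda>x. indicator (- P) x) g"
  shows "\<forall>h u v. L2 h \<and> (AE x in lebesgue. x \<notin> \<Omega> \<longrightarrow> h x = 0) \<and>
            L2 u \<and> is_fresnel_of fr h u \<and> L2 v \<and> is_fourier_of h v \<longrightarrow>
            L2_norm (\<lambda>x. indicator (- K) x * u x)
              \<le> L2_norm (\<lambda>\<xi>. complex_of_real (cmod (g (\<xi> /\<^sub>R fr))) * v \<xi>)"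
proof (intro allI impI, elim conjE)
  fix h u v :: "'a \<Rightarrow> complex"
  assume h: "L2 h" and h_supp: "AE x in lebesgue. x \<notin> \<Omega> \<longrightarrow> h x = 0"
    and u: "L2 u" and u_rep: "is_fresnel_of fr h u" and v: "L2 v" and v_rep: "is_fourier_of h v"
  have ex: "\<exists>f'. f' \<in> borel_measurable borel \<and> (AE x in lborel. f x = f' x) \<and> integrable lborel (\<lambda>x. (cmod (f' x))\<^sup>2)"
    if "L2 f" for f :: "'a \<Rightarrow> complex"
  proof -
    have "f \<in> borel_measurable lebesgue" using that by (simp add: L2_def)
    from ex_borel_representative[OF this]
    obtain f' where f'[measurable]: "f' \<in> borel_measurable borel" and ae: "AE x in lborel. f x = f' x" .
    have "integrable lebesgue (\<lambda>x. (cmod (f x))\<^sup>2) \<longleftrightarrow> integrable lborel (\<lambda>x. (cmod (f' x))\<^sup>2)"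
      by (rule integral_lebesgue_eq_lborel(2)) (use ae in \<open>auto elim!: eventually_mono\<close>)
    with that f' ae show ?thesis unfolding L2_def by blast
  qed
  obtain h' where h': "h' \<in> borel_measurable borel" "AE x in lborel. h x = h' x" "integrable lborel (\<lambda>x. (cmod (h' x))\<^sup>2)"
    using ex[OF h] by blast
  obtain u' where u': "u' \<in> borel_measurable borel" "AE x in lborel. u x = u' x" "integrable lborel (\<lambda>x. (cmod (u' x))\<^sup>2)"
    using ex[OF u] by blast
  obtain v' where v': "v' \<in> borel_measurable borel" "AE x in lborel. v x = v' x" "integrable lborel (\<lambda>x. (cmod (v' x))\<^sup>2)"
    using ex[OF v] by blast
  have "g \<in> borel_measurable lebesgue" using g_Linf by (simp add: Linf_def)
  from ex_borel_representative[OF this]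
  obtain g1 where g1: "g1 \<in> borel_measurable borel" "AE x in lborel. g x = g1 x" .
  obtain B where "AE x in lebesgue. cmod (g x) \<le> B" using g_Linf unfolding Linf_def by blast
  then have gB: "AE x in lborel. cmod (g x) \<le> max B 0" by (auto simp: AE_completion_iff elim!: eventually_mono)
  define g' where "g' = (\<lambda>x. if cmod (g1 x) \<le> max B 0 then g1 x else 0)"
  have g'm: "g' \<in> borel_measurable borel" unfolding g'_def using g1(1) by measurable
  have g'ae: "AE x in lborel. g x = g' x" using g1(2) gB by eventually_elim (auto simp: g'_def)
  have g'B: "cmod (g' x) \<le> max B 0" for x by (auto simp: g'_def)
  have "- P \<in> sets lebesgue" using sets.compl_sets[OF P_meas] by (simp add: Compl_eq_Diff_UNIV)
  from sets_completionE[OF this]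
  obtain Q NQ NQ' where Q: "- P = Q \<union> NQ" "NQ \<subseteq> NQ'" "NQ' \<in> null_sets lborel" "Q \<in> sets lborel" .
  have "- K \<in> sets lebesgue" using sets.compl_sets[OF K_meas] by (simp add: Compl_eq_Diff_UNIV)
  from sets_completionE[OF this]
  obtain C NC NC' where C: "- K = C \<union> NC" "NC \<subseteq> NC'" "NC' \<in> null_sets lborel" "C \<in> sets lborel" .
  have Qm: "Q \<in> sets borel" and Cm: "C \<in> sets borel" using Q C by auto
  have Qae: "AE x in lborel. x \<notin> P \<longleftrightarrow> x \<in> Q"
    using AE_not_in[OF Q(3)] by eventually_elim (use Q(1,2) in auto)
  have Cae: "AE x in lborel. x \<notin> K \<longleftrightarrow> x \<in> C"
    using AE_not_in[OF C(3)] by eventually_elim (use C(1,2) in auto)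
  have "is_fresnel_of fr (indicator Q) g'"
  proof (rule is_fourier_is_fresnel_AE_cong(2)[OF _ _ g'm g'ae g_rep])
    show "(indicator Q :: 'a \<Rightarrow> complex) \<in> borel_measurable borel" using Qm by simp
    show "AE x in lborel. indicator (- P) x = (indicator Q x :: complex)"
      using Qae by eventually_elim (auto simp: indicator_def)
  qed
  moreover have "is_fresnel_of fr h' u'" by (rule is_fourier_is_fresnel_AE_cong(2)[OF h'(1,2) u'(1,2) u_rep])
  moreover have "is_fourier_of h' v'" by (rule is_fourier_is_fresnel_AE_cong(1)[OF h'(1,2) v'(1,2) v_rep])
  moreover have "AE y in lborel. h' y \<noteq> 0 \<longrightarrow> x - y \<in> Q" if "x \<in> C" for x
  proof -
    have "x \<notin> K" using that C(1) by auto
    then have *: "x - y \<notin> P" if "y \<in> \<Omega>" for y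
      using sum_sub that by (smt (verit) mem_Collect_eq subsetD add_diff_cancel_left' diff_add_cancel add.commute)
    have "AE y in lborel. x + (-1) *\<^sub>R y \<notin> P \<longleftrightarrow> x + (-1) *\<^sub>R y \<in> Q"
      by (rule AE_lborel_affine[OF Qae]) simp
    moreover have "AE y in lborel. y \<notin> \<Omega> \<longrightarrow> h y = 0" using h_supp by (simp add: AE_completion_iff)
    ultimately show ?thesis using h'(2) by eventually_elim (use * in auto)
  qed
  ultimately have main: "(LINT x|lborel. indicator C x * (cmod (u' x))\<^sup>2)
      \<le> (LINT \<xi>|lborel. (cmod (g' (\<xi> /\<^sub>R fr)))\<^sup>2 * (cmod (v' \<xi>))\<^sup>2)"
    by (intro fresnel_leak_borel[OF fr_pos Cm Qm h'(1) u'(1) v'(1) g'm h'(3) u'(3) v'(3) g'B])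
  have "(LINT x|lebesgue. (cmod (indicator (- K) x * u x))\<^sup>2) = (LINT x|lborel. indicator C x * (cmod (u' x))\<^sup>2)"
  proof (rule integral_lebesgue_eq_lborel(1))
    show "(\<lambda>x. indicator C x * (cmod (u' x))\<^sup>2) \<in> borel_measurable borel" using Cm u'(1) by measurable
    show "AE x in lborel. (cmod (indicator (- K) x * u x))\<^sup>2 = indicator C x * (cmod (u' x))\<^sup>2"
      using Cae u'(2) by eventually_elim (auto simp: indicator_def)
  qed
  moreover have "(LINT \<xi>|lebesgue. (cmod (complex_of_real (cmod (g (\<xi> /\<^sub>R fr))) * v \<xi>))\<^sup>2)
      = (LINT \<xi>|lborel. (cmod (g' (\<xi> /\<^sub>R fr)))\<^sup>2 * (cmod (v' \<xi>))\<^sup>2)"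
  proof (rule integral_lebesgue_eq_lborel(1))
    show "(\<lambda>\<xi>. (cmod (g' (\<xi> /\<^sub>R fr)))\<^sup>2 * (cmod (v' \<xi>))\<^sup>2) \<in> borel_measurable borel" using g'm v'(1) by measurable
    have "AE \<xi> in lborel. g (0 + inverse fr *\<^sub>R \<xi>) = g' (0 + inverse fr *\<^sub>R \<xi>)"
      using fr_pos by (intro AE_lborel_affine[OF g'ae]) simp
    then show "AE \<xi> in lborel. (cmod (complex_of_real (cmod (g (\<xi> /\<^sub>R fr))) * v \<xi>))\<^sup>2 = (cmod (g' (\<xi> /\<^sub>R fr)))\<^sup>2 * (cmod (v' \<xi>))\<^sup>2"
      using v'(2) by eventually_elim (auto simp: norm_mult power_mult_distrib)
  qed
  ultimately show "L2_norm (\<lambda>x. indicator (- K) x * u x) \<le> L2_norm (\<lambda>\<xi>. complex_of_real (cmod (g (\<xi> /\<^sub>R fr))) * v \<xi>)"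
    unfolding L2_norm_def using main by simp
qed

end
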